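(* Let $n\ge 1$, $\delta>0$, $\epsilon\in(0,1/2)$, $\mu\in\mathbb{R}^n$, and let $\Sigma\in\mathbb{R}^{n\times n}$ be symmetric positive definite. Let $\mathcal{Z}\subseteq\mathbb{R}^{n+2}$ and $\mathcal{Z}_0\subseteq\mathbb{R}^2$ be the feasible sets of the two-sided distributionally robust chance constraints defined in the context, and let $\|x\|_*=\|\Sigma^{1/2}x\|_2$. Define $$g_\epsilon(\ell,u):=\int_0^{+\infty}\big[\Phi(u-t)-\Phi(\ell+t)-(1-\epsilon)\big]^+\,dt,\qquad (\ell,u)\in\mathbb{R}^2,$$ and $$\mathcal{Z}_1:=\operatorname{cl}\{(\ell,u,s)\in\mathbb{R}^3 : s>0,\ (\ell/s,u/s)\in\mathcal{Z}_0\},$$ where $\operatorname{cl}$ denotes closure. Then: (i) $\mathcal{Z}_0=\{(\ell,u)\in\mathbb{R}^2 : \delta\le g_\epsilon(\ell,u)\}$; (ii) for $(x,\ell,u)\in\mathbb{R}^{n}\times\mathbb{R}\times\mathbb{R}$, one has $(x,\ell,u)\in\mathcal{Z}$ if and only if there exists $s\ge\|x\|_*$ such that $(\ell-x^\top\mu,\;u-x^\top\mu,\;s)\in\mathcal{Z}_1$; (iii) both $\mathcal{Z}_0$ and $\mathcal{Z}$ are convex and closed.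
   Context: $\Phi$ is the cumulative distribution function of the one-dimensional standard Gaussian, and $[a]^+=\max\{a,0\}$. Wasserstein distance: for probability distributions $\mathbb{P}_1,\mathbb{P}_2$ on $\mathbb{R}^k$ and a norm $\|\cdot\|$ on $\mathbb{R}^k$, $d_W(\mathbb{P}_1,\mathbb{P}_2):=\inf \mathbb{E}[\|\tilde X_1-\tilde X_2\|]$, the infimum being over all couplings $(\tilde X_1,\tilde X_2)$ with $\tilde X_1\sim\mathbb{P}_1$, $\tilde X_2\sim\mathbb{P}_2$. Set $\mathcal{Z}$: let $\mathbb{P}=\mathcal{N}(\mu,\Sigma)$ on $\mathbb{R}^n$ and let $d_W$ be the Wasserstein distance on $\mathbb{R}^n$ for the norm $\|y\|=\|\Sigma^{-1/2}y\|_2$, whose dual norm is $\|x\|_*=\|\Sigma^{1/2}x\|_2$. Let $\mathcal{P}$ be the set of all probability distributions $\mathbb{Q}$ on $\mathbb{R}^n$ with $d_W(\mathbb{Q},\mathbb{P})\le\delta$. Then $$\mathcal{Z}:=\Big\{(x,\ell,u)\in\mathbb{R}^{n+2}:\ \inf_{\mathbb{Q}\in\mathcal{P}}\mathbb{Q}\big[\ell\le x^\top\tilde\xi\le u\big]\ge 1-\epsilon\Big\},$$ where $\tilde\xi$ is the random vector with distribution $\mathbb{Q}$. Set $\mathcal{Z}_0$: let $\mathcal{P}_0$ be the set of all probability distributions $\mathbb{Q}$ on $\mathbb{R}$ whose Wasserstein distance (for the norm $|\cdot|$) to the standard Gaussian distribution $\mathbb{P}_0=\mathcal{N}(0,1)$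 is at most $\delta$. Then $$\mathcal{Z}_0:=\Big\{(\ell,u)\in\mathbb{R}^2:\ \inf_{\mathbb{Q}\in\mathcal{P}_0}\mathbb{Q}\big[\ell\le\tilde\xi\le u\big]\ge1-\epsilon\Big\},$$ where $\tilde\xi$ is the real random variable with distribution $\mathbb{Q}$. *)

theory Defs
  imports "HOL-Probability.Probability"
begin

definition couplings ::
    "'a::euclidean_space measure \<Rightarrow> 'a measure \<Rightarrow> ('a \<times> 'a) measure set" where
  "couplings P Q = {\<pi>. prob_space \<pi> \<and> sets \<pi> = sets borel \<and>
     distr \<pi> borel fst = P \<and> distr \<pi> borel snd = Q}"

(* The parameter N is the norm on the underlying space. The value is an extended
   nonnegative real, since the expected distance may be infinite. *)
definition wasserstein ::
    "('a::euclidean_space \<Rightarrow> real) \<Rightarrow> 'a measure \<Rightarrow> 'a measure \<Rightarrow> ennreal" where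
  "wasserstein N P Q =
     (INF \<pi>\<in>couplings P Q. \<integral>\<^sup>+z. ennreal (N (fst z - snd z)) \<partial>\<pi>)"

definition wasserstein_ball ::
    "('a::euclidean_space \<Rightarrow> real) \<Rightarrow> real \<Rightarrow> 'a measure \<Rightarrow> 'a measure set" where
  "wasserstein_ball N \<delta> P =
     {Q. prob_space Q \<and> sets Q = sets borel \<and> wasserstein N Q P \<le> ennreal \<delta>}"

definition sym_pos_def :: "real^'n^'n \<Rightarrow> bool" where
  "sym_pos_def A \<longleftrightarrow> transpose A = A \<and> (\<forall>x. x \<noteq> 0 \<longrightarrow> 0 < x \<bullet> (A *v x))"

(* The principal square root. Meaningful for symmetric positive definite A, where
   exactly one such B exists. *)
definition matrix_sqrt :: "real^'n^'n \<Rightarrow> real^'n^'n" where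
  "matrix_sqrt A = (THE B. sym_pos_def B \<and> B ** B = A)"

(* The Gaussian distribution with mean m and (nonsingular) covariance matrix V. *)
definition gaussian :: "real^'n \<Rightarrow> real^'n^'n \<Rightarrow> (real^'n) measure" where
  "gaussian m V = density lborel (\<lambda>y. ennreal
     (exp (- ((y - m) \<bullet> (matrix_inv V *v (y - m))) / 2)
        / sqrt ((2 * pi) ^ CARD('n) * det V)))"

definition primal_norm :: "real^'n^'n \<Rightarrow> real^'n \<Rightarrow> real" where
  "primal_norm V y = norm (matrix_inv (matrix_sqrt V) *v y)"

definition dual_norm :: "real^'n^'n \<Rightarrow> real^'n \<Rightarrow> real" where
  "dual_norm V x = norm (matrix_sqrt V *v x)"

definition Z_set ::
    "real^'n \<Rightarrow> real^'n^'n \<Rightarrow> real \<Rightarrow> real \<Rightarrow> ((real^'n) \<times> real \<times> real) set" where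
  "Z_set m V \<delta> \<epsilon> = {(x, l, u).
     (INF Q\<in>wasserstein_ball (primal_norm V) \<delta> (gaussian m V).
        measure Q {\<xi>. l \<le> x \<bullet> \<xi> \<and> x \<bullet> \<xi> \<le> u}) \<ge> 1 - \<epsilon>}"

definition Z0_set :: "real \<Rightarrow> real \<Rightarrow> (real \<times> real) set" where
  "Z0_set \<delta> \<epsilon> = {(l, u).
     (INF Q\<in>wasserstein_ball abs \<delta> std_normal_distribution.
        measure Q {\<xi>. l \<le> \<xi> \<and> \<xi> \<le> u}) \<ge> 1 - \<epsilon>}"

definition Z1_set :: "real \<Rightarrow> real \<Rightarrow> (real \<times> real \<times> real) set" where
  "Z1_set \<delta> \<epsilon> = closure {(l, u, s). s > 0 \<and> (l / s, u / s) \<in> Z0_set \<delta> \<epsilon>}"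

abbreviation Phi :: "real \<Rightarrow> real" where
  "Phi \<equiv> cdf std_normal_distribution"

definition g :: "real \<Rightarrow> real \<Rightarrow> real \<Rightarrow> real" where
  "g \<epsilon> l u = (LINT t:{0..}|lborel. max (Phi (u - t) - Phi (l + t) - (1 - \<epsilon>)) 0)"

end

theory Submission
  imports Defs
begin

text \<open>
  The theorem rests on a one-dimensional optimal transport problem. To make \<open>l \<le> \<xi> \<le> u\<close> fail with probability more than
  \<open>\<epsilon>\<close>, an adversary has to move standard normal mass out of the interval, and moves the mass nearest to the boundary
  first. The mass at distance more than \<open>t\<close> from the complement of the interval is
  \<open>core_mass l u t = Phi (u - t) - Phi (l + t)\<close>, so by the layer-cake formula the least cost of leaving only \<open>1 - \<epsilon>\<close> inside
  is \<open>g \<epsilon> l u\<close>. The constraint is robust iff this cost is at least \<open>\<delta>\<close>. The lower bound for all couplings is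
  \<open>measure_ge_if_g_ge\<close> and the adversary is constructed in \<open>violating_distribution\<close>.

  Both steps are carried out for a distribution on any Euclidean space with a functional that is standard normal and
  compatible with the norm (locale \<open>normal_projection\<close>). On the real line this gives the description of \<open>Z0_set\<close>. For the
  Gaussian on \<open>real^'n\<close> and \<open>x \<noteq> 0\<close> it applies to \<open>y \<mapsto> (x \<bullet> y - x \<bullet> m) / dual_norm V x\<close>, so that membership in \<open>Z_set\<close>
  becomes membership in \<open>Z0_set\<close> after division by \<open>dual_norm V x\<close>. The analytic input is that this functional is standard
  normal (\<open>gaussian_affine_marginal\<close>), which needs the existence of the matrix square root and the behaviour of Lebesgue
  measure under invertible matrices.

  For the geometry, \<open>g\<close> is continuous, and its superlevel sets are convex (\<open>convex_g_superlevel\<close>): for \<open>\<epsilon> < 1 / 2\<close> the relevant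
  arguments of \<open>Phi\<close> lie where the core mass is jointly concave, and the weighted inequality between arithmetic and harmonic
  means controls the change of the range of integration. The set \<open>Z1_set\<close> is the closed convex cone over \<open>Z0_set\<close>; it contains
  \<open>(l, u, r)\<close> whenever it contains \<open>(l, u, s)\<close> and \<open>0 \<le> r \<le> s\<close>, so that \<open>Z_set\<close> is its preimage under
  \<open>(x, l, u) \<mapsto> (l - x \<bullet> m, u - x \<bullet> m, dual_norm V x)\<close>. Closedness follows at once, and convexity from that of the dual norm.
\<close>

section \<open>Lebesgue measure under invertible matrices\<close>

lemma nn_integral_lborel_translate:
  fixes h :: "'a::euclidean_space \<Rightarrow> ennreal"
  assumes [measurable]: "h \<in> borel_measurable borel"
  shows "(\<integral>\<^sup>+x. h (a + x) \<partial>lborel) = (\<integral>\<^sup>+x. h x \<partial>lborel)"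
  by (subst (2) lborel_distr_plus[of a, symmetric]) (simp add: nn_integral_distr)

lemma nn_integral_lborel_reflect:
  fixes h :: "'a::euclidean_space \<Rightarrow> ennreal"
  assumes [measurable]: "h \<in> borel_measurable borel"
  shows "(\<integral>\<^sup>+x. h (a - x) \<partial>lborel) = (\<integral>\<^sup>+x. h x \<partial>lborel)"
proof -
  have "lborel = distr lborel borel (\<lambda>x. a - x)"
    using lborel_affine[of "-1" a] by (simp add: density_1)
  then have "(\<integral>\<^sup>+x. h x \<partial>lborel) = (\<integral>\<^sup>+x. h x \<partial>distr lborel borel (\<lambda>x. a - x))"
    by simp
  also have "\<dots> = (\<integral>\<^sup>+x. h (a - x) \<partial>lborel)"
    by (simp add: nn_integral_distr)
  finally show ?thesis by simp
qed

text \<open>Uniqueness of Haar measure gives \<open>emeasure lborel (T -` E) = c * emeasure lborel E\<close> with a constant \<open>c\<close>,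
  and applying \<open>T\<close> twice forces \<open>c * c = 1\<close>. The uniqueness argument is the classical double integral of
  \<open>indicator E (T x) * indicator F (T x + y)\<close>, whose two orders of integration exchange the roles of \<open>E\<close> and \<open>F\<close>.\<close>

lemma emeasure_linear_involution:
  fixes T :: "'a::euclidean_space \<Rightarrow> 'a"
  assumes "linear T" and inv: "\<And>x. T (T x) = x" and E: "E \<in> sets borel"
  shows "emeasure lborel (T -` E) = emeasure lborel E"
proof -
  have [measurable]: "T \<in> borel \<rightarrow>\<^sub>M borel"
    using assms(1) by (intro borel_measurable_continuous_onI linear_continuous_on) (simp add: linear_conv_bounded_linear)
  have Tm: "T -` E \<in> sets borel" if "E \<in> sets borel" for E
    using measurable_sets[OF \<open>T \<in> borel \<rightarrow>\<^sub>M borel\<close> that] by simp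
  have Ti: "emeasure lborel (T -` E) = (\<integral>\<^sup>+x. indicator E (T x) \<partial>lborel)" if "E \<in> sets borel" for E
    using nn_integral_indicator[of "T -` E" lborel] Tm[OF that] by (simp add: indicator_vimage)
  have prod: "emeasure lborel (T -` E) * emeasure lborel F = emeasure lborel E * emeasure lborel (T -` F)"
    if [measurable]: "E \<in> sets borel" "F \<in> sets borel" for E F
  proof -
    have "emeasure lborel (T -` E) * emeasure lborel F
        = (\<integral>\<^sup>+x. indicator E (T x) * (\<integral>\<^sup>+y. indicator F y \<partial>lborel) \<partial>lborel)"
      by (simp add: Ti nn_integral_multc)
    also have "\<dots> = (\<integral>\<^sup>+x. indicator E (T x) * (\<integral>\<^sup>+y. indicator F (T x + y) \<partial>lborel) \<partial>lborel)"
      by (subst nn_integral_lborel_translate) simp_all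
    also have "\<dots> = (\<integral>\<^sup>+x. (\<integral>\<^sup>+y. indicator E (T x) * indicator F (T x + y) \<partial>lborel) \<partial>lborel)"
      by (subst nn_integral_cmult) simp_all
    also have "\<dots> = (\<integral>\<^sup>+y. (\<integral>\<^sup>+x. indicator E (T x) * indicator F (T x + y) \<partial>lborel) \<partial>lborel)"
      by (rule lborel_pair.Fubini'[symmetric]) simp
    also have "\<dots> = (\<integral>\<^sup>+y. (\<integral>\<^sup>+x. indicator E (T x - y) * indicator F (T x) \<partial>lborel) \<partial>lborel)"
    proof (rule nn_integral_cong)
      fix y
      have "(\<integral>\<^sup>+x. indicator E (T x - y) * indicator F (T x) \<partial>lborel)
          = (\<integral>\<^sup>+x. indicator E (T (T y + x) - y) * indicator F (T (T y + x)) \<partial>lborel)"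
        by (rule nn_integral_lborel_translate[symmetric]) simp
      then show "(\<integral>\<^sup>+x. indicator E (T x) * indicator F (T x + y) \<partial>lborel)
          = (\<integral>\<^sup>+x. indicator E (T x - y) * indicator F (T x) \<partial>lborel)"
        by (simp add: linear_add[OF assms(1)] inv add.commute)
    qed
    also have "\<dots> = (\<integral>\<^sup>+x. (\<integral>\<^sup>+y. indicator E (T x - y) * indicator F (T x) \<partial>lborel) \<partial>lborel)"
      by (rule lborel_pair.Fubini') simp
    also have "\<dots> = (\<integral>\<^sup>+x. (\<integral>\<^sup>+y. indicator E (T x - y) \<partial>lborel) * indicator F (T x) \<partial>lborel)"
      by (subst nn_integral_multc) simp_all
    also have "\<dots> = (\<integral>\<^sup>+x. (\<integral>\<^sup>+y. indicator E y \<partial>lborel) * indicator F (T x) \<partial>lborel)"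
      by (subst nn_integral_lborel_reflect) simp_all
    also have "\<dots> = emeasure lborel E * emeasure lborel (T -` F)"
      by (simp add: Ti nn_integral_cmult)
    finally show ?thesis .
  qed
  define U :: "'a set" where "U = box 0 One"
  have U: "U \<in> sets borel" "emeasure lborel U = 1"
    by (auto simp: U_def)
  define c where "c = emeasure lborel (T -` U)"
  have c: "emeasure lborel (T -` E) = c * emeasure lborel E" if "E \<in> sets borel" for E
    using prod[OF that U(1)] by (simp add: U(2) c_def mult.commute)
  have "T -` T -` U = U" by (auto simp: inv)
  then have "c * c = 1"
    using c[OF Tm[OF U(1)]] c[OF U(1)] U(2) by simp
  then have "c = 1"
    by (cases c) (auto simp: ennreal_mult[symmetric] ennreal_top_mult square_eq_1_iff simp flip: ennreal_1)
  with c[OF E] show ?thesis by simp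
qed

lemma det_involution:
  fixes A :: "real^'n^'n"
  assumes "A ** A = mat 1"
  shows "\<bar>det A\<bar> = 1"
proof -
  have "det A * det A = 1" using assms by (metis det_I det_mul)
  then show ?thesis by (auto simp: square_eq_1_iff)
qed

lemma measurable_matrix_vector_mul [measurable]:
  fixes A :: "real^'n^'m"
  shows "(*v) A \<in> borel_measurable borel"
  by (intro borel_measurable_continuous_onI linear_continuous_on) simp

text \<open>The formula is multiplicative in \<open>A\<close>, so elementary matrices suffice. Diagonal matrices rescale the axes,
  while transpositions are involutions and shears are products of two involutions, so that
  \<open>emeasure_linear_involution\<close> applies to them.\<close>

lemma emeasure_vimage_matrix:
  fixes A :: "real^'n^'n"
  assumes "det A \<noteq> 0" "E \<in> sets borel"
  shows "emeasure lborel E = ennreal \<bar>det A\<bar> * emeasure lborel ((*v) A -` E)"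
proof -
  define P :: "real^'n^'n \<Rightarrow> bool" where
    "P = (\<lambda>A. det A \<noteq> 0 \<longrightarrow> (\<forall>E\<in>sets borel. emeasure lborel E = ennreal \<bar>det A\<bar> * emeasure lborel ((*v) A -` E)))"
  have mult: "P (A ** B)" if PA: "P A" and PB: "P B" for A B
    unfolding P_def
  proof (intro impI ballI)
    fix E :: "(real^'n) set"
    assume "det (A ** B) \<noteq> 0" and E: "E \<in> sets borel"
    then have d: "det A \<noteq> 0" "det B \<noteq> 0" by (auto simp: det_mul)
    have E': "(*v) A -` E \<in> sets borel"
      using measurable_sets[OF measurable_matrix_vector_mul E] by simp
    have eq: "(*v) B -` (*v) A -` E = (*v) (A ** B) -` E"
      by (auto simp: matrix_vector_mul_assoc)
    show "emeasure lborel E = ennreal \<bar>det (A ** B)\<bar> * emeasure lborel ((*v) (A ** B) -` E)"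
      using PA[unfolded P_def, rule_format, OF d(1) E] PB[unfolded P_def, rule_format, OF d(2) E']
      by (simp add: eq det_mul abs_mult ennreal_mult mult.assoc)
  qed
  have invol: "P A" if "A ** A = mat 1" for A
    unfolding P_def
  proof (intro impI ballI)
    fix E :: "(real^'n) set" assume E: "E \<in> sets borel"
    have "emeasure lborel ((*v) A -` E) = emeasure lborel E"
      by (intro emeasure_linear_involution E) (simp_all add: matrix_vector_mul_assoc that)
    then show "emeasure lborel E = ennreal \<bar>det A\<bar> * emeasure lborel ((*v) A -` E)"
      by (simp add: det_involution[OF that])
  qed
  have "P A"
  proof (induction A rule: induct_matrix_elementary_alt)
    case (1 A B) then show ?case by (rule mult)
  next
    case (2 A i) then show ?case by (auto simp: P_def det_zero_row)
  next
    case (3 A)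
    show ?case unfolding P_def
    proof (intro impI ballI)
      fix E :: "(real^'n) set" assume nz: "det A \<noteq> 0" and E: "E \<in> sets borel"
      have det: "det A = (\<Prod>i\<in>UNIV. A $ i $ i)" by (rule det_diagonal) (rule 3)
      define c :: "real^'n \<Rightarrow> real" where "c b = A $ axis_index b $ axis_index b" for b
      have T: "0 + (\<Sum>j\<in>Basis. (c j * (x \<bullet> j)) *\<^sub>R j) = A *v x" for x :: "real^'n"
      proof -
        have "(\<Sum>j\<in>Basis. (c j * (x \<bullet> j)) *\<^sub>R j) = (\<Sum>i\<in>UNIV. (A $ i $ i * x $ i) *\<^sub>R axis i 1)"
          by (simp add: Basis_vec_def sum.UNION_disjoint_family UNION_singleton_eq_range sum.reindex inj_on_def axis_eq_axis c_def inner_axis axis_index_axis)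
        also have "\<dots> = A *v x"
        proof (subst vec_eq_iff, rule allI)
          fix i
          have "(A *v x) $ i = (\<Sum>j\<in>UNIV. if j = i then A $ i $ i * x $ i else 0)"
            unfolding matrix_vector_mult_def by (simp only: vec_lambda_beta, rule sum.cong) (simp_all add: 3)
          also have "\<dots> = (\<Sum>i\<in>UNIV. (A $ i $ i * x $ i) *\<^sub>R axis i (1::real)) $ i"
            by (auto simp: axis_def if_distrib[of "\<lambda>a. _ * a"] cong: if_cong)
          finally show "(\<Sum>i\<in>UNIV. (A $ i $ i * x $ i) *\<^sub>R axis i (1::real)) $ i = (A *v x) $ i" by simp
        qed
        finally show ?thesis by simp
      qed
      have cprod: "(\<Prod>j\<in>Basis. \<bar>c j\<bar>) = \<bar>det A\<bar>"
        by (simp add: det abs_prod Basis_vec_def UNION_singleton_eq_range prod.reindex inj_on_def axis_eq_axis c_def axis_index_axis)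
      have c0: "c j \<noteq> 0" if "j \<in> Basis" for j
        using nz det by (simp add: c_def)
      have "lborel = density (distr lborel borel ((*v) A)) (\<lambda>_. ennreal \<bar>det A\<bar>)"
        using lborel_affine_euclidean[of c 0, OF c0] by (simp only: T cprod)
      then have "emeasure lborel E = emeasure (density (distr lborel borel ((*v) A)) (\<lambda>_. ennreal \<bar>det A\<bar>)) E"
        by simp
      also have "\<dots> = ennreal \<bar>det A\<bar> * emeasure lborel ((*v) A -` E)"
        using E by (simp add: emeasure_density nn_integral_cmult emeasure_distr)
      finally show "emeasure lborel E = ennreal \<bar>det A\<bar> * emeasure lborel ((*v) A -` E)" .
    qed
  next
    case (4 m n)
    have swapv: "((\<chi> i j. mat 1 $ i $ Transposition.transpose m n j) *v x) $ i = x $ Transposition.transpose m n i"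
      for x :: "real^'n" and i
    proof -
      have "((\<chi> i j. mat 1 $ i $ Transposition.transpose m n j) *v x) $ i
          = (\<Sum>j\<in>UNIV. if j = Transposition.transpose m n i then x $ j else 0)"
        unfolding matrix_vector_mult_def mat_def
        by (simp only: vec_lambda_beta, rule sum.cong) (auto simp: transpose_eq_iff)
      then show ?thesis by simp
    qed
    show ?case
    proof (rule invol)
      show "(\<chi> i j. mat 1 $ i $ Transposition.transpose m n j) ** (\<chi> i j. mat 1 $ i $ Transposition.transpose m n j) = (mat 1 :: real^'n^'n)"
        by (simp add: matrix_eq flip: matrix_vector_mul_assoc) (simp add: vec_eq_iff swapv)
    qed
  next
    case (5 m n)
    \<comment> \<open>The shear \<open>S\<close> adds coordinate \<open>n\<close> to coordinate \<open>m\<close>; negating coordinate \<open>m\<close> afterwards makes it an involution.\<close>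
    define R :: "real^'n^'n" where "R = (\<chi> i j. if i = j then (if i = m then -1 else 1) else 0)"
    define S :: "real^'n^'n" where "S = (\<chi> i j. of_bool (i = m \<and> j = n \<or> i = j))"
    have Rv: "(R *v x) $ i = (if i = m then - x $ m else x $ i)" for x i
      unfolding matrix_vector_mult_def R_def
      by (simp add: if_distrib[of "\<lambda>a. a * _"] cong: if_cong)
    have Sv: "(S *v x) $ i = (if i = m then x $ m + x $ n else x $ i)" for x i
    proof -
      have "(S *v x) $ i = (\<Sum>j\<in>UNIV. (if j = i then x $ j else 0) + (if i = m \<and> j = n then x $ j else 0))"
        unfolding matrix_vector_mult_def S_def
        using 5 by (simp only: vec_lambda_beta, intro sum.cong) auto
      then show ?thesis by (simp add: sum.distrib)
    qed
    have RR: "R ** R = mat 1"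
      by (simp add: matrix_eq flip: matrix_vector_mul_assoc) (simp add: vec_eq_iff Rv)
    have RS: "(R ** S) ** (R ** S) = mat 1"
      using 5 by (simp add: matrix_eq flip: matrix_vector_mul_assoc) (simp add: vec_eq_iff Rv Sv)
    have "P (R ** (R ** S))" by (intro mult invol RR RS)
    then show ?case by (simp add: matrix_mul_assoc RR S_def)
  qed
  with assms show ?thesis by (simp add: P_def)
qed

section \<open>Square roots of positive definite matrices\<close>

lemma sym_pos_def_inner:
  assumes "sym_pos_def A" shows "x \<bullet> (A *v y) = (A *v x) \<bullet> y"
  using assms dot_lmul_matrix[of x A y] by (simp add: sym_pos_def_def flip: vector_transpose_matrix)

lemma sym_pos_def_pos: "sym_pos_def A \<Longrightarrow> x \<noteq> 0 \<Longrightarrow> 0 < x \<bullet> (A *v x)"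
  by (simp add: sym_pos_def_def)

lemma sym_pos_def_nonneg: "sym_pos_def A \<Longrightarrow> 0 \<le> x \<bullet> (A *v x)"
  by (cases "x = 0") (auto dest: sym_pos_def_pos[of _ x])

lemma sym_pos_def_mult_eq_0_iff: "sym_pos_def A \<Longrightarrow> A *v x = 0 \<longleftrightarrow> x = 0"
  by (metis inner_zero_right less_irrefl matrix_vector_mult_0_right sym_pos_def_pos)

lemma sym_pos_def_invertible:
  assumes "sym_pos_def A" shows "invertible A"
  using assms by (simp add: invertible_left_inverse matrix_left_invertible_ker sym_pos_def_mult_eq_0_iff)

text \<open>The constant is the minimum of the Rayleigh quotient, attained on the compact unit sphere.\<close>

lemma sym_pos_def_coercive:
  fixes A :: "real^'n^'n"
  assumes A: "sym_pos_def A"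
  obtains \<alpha> where "\<alpha> > 0" "\<And>x. \<alpha> * (x \<bullet> x) \<le> x \<bullet> (A *v x)"
proof -
  have ne: "sphere (0::real^'n) 1 \<noteq> {}"
    by (metis dist_0_norm empty_iff mem_sphere norm_axis_1)
  have "continuous_on (sphere 0 1) (\<lambda>x. x \<bullet> (A *v x))"
    by (intro continuous_intros linear_continuous_on matrix_vector_mul_bounded_linear)
  from continuous_attains_inf[OF compact_sphere ne this] obtain z
    where z: "z \<in> sphere 0 1" and min: "\<And>y. y \<in> sphere 0 1 \<Longrightarrow> z \<bullet> (A *v z) \<le> y \<bullet> (A *v y)"
    by blast
  show ?thesis
  proof
    from z have "z \<noteq> 0" by auto
    with A show "0 < z \<bullet> (A *v z)" by (rule sym_pos_def_pos)
    fix x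
    show "(z \<bullet> (A *v z)) * (x \<bullet> x) \<le> x \<bullet> (A *v x)"
    proof (cases "x = 0")
      case False
      have "z \<bullet> (A *v z) \<le> (x /\<^sub>R norm x) \<bullet> (A *v (x /\<^sub>R norm x))"
        using False by (intro min) simp
      also have "\<dots> = (x \<bullet> (A *v x)) / (x \<bullet> x)"
        by (simp add: matrix_vector_mult_scaleR dot_square_norm power2_eq_square divide_simps)
      finally show ?thesis using False by (simp add: pos_le_divide_eq)
    qed simp
  qed
qed

text \<open>If \<open>C = 1 - A / c\<close> has norm \<open>q < 1\<close>, the map \<open>X \<mapsto> (C + X * X) / 2\<close> is a contraction with constant \<open>q\<close> on the
  self-adjoint operators of norm at most \<open>q\<close>. Its fixed point satisfies \<open>(1 - X) * (1 - X) = 1 - C = A / c\<close>, and \<open>1 - X\<close>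
  is positive definite because \<open>X\<close> has norm less than 1.\<close>

lemma sym_pos_def_sqrt_exists:
  fixes A :: "real^'n^'n"
  assumes A: "sym_pos_def A"
  shows "\<exists>B. sym_pos_def B \<and> B ** B = A"
proof -
  obtain \<alpha> where \<alpha>: "\<alpha> > 0" "\<And>x. \<alpha> * (x \<bullet> x) \<le> x \<bullet> (A *v x)"
    using sym_pos_def_coercive[OF A] by blast
  obtain K where K: "\<And>x. norm (A *v x) \<le> norm x * K" "K > 0"
    using bounded_linear.pos_bounded[OF matrix_vector_mul_bounded_linear[of A]] by blast
  \<comment> \<open>Large enough for \<open>norm (x - A x / c)\<^sup>2 \<le> (1 - 2 \<alpha> / c + K\<^sup>2 / c\<^sup>2) (x \<bullet> x)\<close> to have a factor at most \<open>1 - \<alpha> / c\<close>.\<close>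
  define c where "c = K\<^sup>2 / \<alpha> + \<alpha>"
  have c: "c > 0" "\<alpha> < c" "K\<^sup>2 \<le> \<alpha> * c"
    using \<alpha>(1) K(2) by (auto simp: c_def field_simps add_pos_pos)
  define q where "q = sqrt (1 - \<alpha> / c)"
  have q: "0 \<le> q" "q < 1" "q\<^sup>2 = 1 - \<alpha> / c"
    using c \<alpha>(1) by (auto simp: q_def field_simps)
  define C where "C = Blinfun (\<lambda>x. x - (1 / c) *\<^sub>R (A *v x))"
  have C: "blinfun_apply C x = x - (1 / c) *\<^sub>R (A *v x)" for x
    unfolding C_def by (subst bounded_linear_Blinfun_apply)
      (auto intro!: bounded_linear_intros)
  have normC: "norm C \<le> q"
  proof (rule norm_blinfun_bound[OF q(1)])
    fix x
    have "(norm (C x))\<^sup>2 = x \<bullet> x - 2 / c * (x \<bullet> (A *v x)) + (norm (A *v x))\<^sup>2 / c\<^sup>2"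
      unfolding power2_norm_eq_inner
      by (simp add: C inner_diff_left inner_diff_right inner_commute[of "A *v x" x] power2_eq_square diff_divide_distrib)
    also have "\<dots> \<le> x \<bullet> x - 2 / c * (\<alpha> * (x \<bullet> x)) + (\<alpha> / c) * (x \<bullet> x)"
    proof -
      have "(norm (A *v x))\<^sup>2 \<le> (norm x * K)\<^sup>2" by (intro power_mono K) simp
      also have "\<dots> = K\<^sup>2 * (x \<bullet> x)" by (simp add: power_mult_distrib power2_norm_eq_inner)
      also have "\<dots> \<le> \<alpha> * c * (x \<bullet> x)" by (intro mult_right_mono c) simp
      finally have "(norm (A *v x))\<^sup>2 / c\<^sup>2 \<le> (\<alpha> / c) * (x \<bullet> x)"
        using c(1) by (simp add: field_simps power2_eq_square)
      moreover have "2 / c * (\<alpha> * (x \<bullet> x)) \<le> 2 / c * (x \<bullet> (A *v x))"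
        using c(1) \<alpha>(2) by (intro mult_left_mono) auto
      ultimately show ?thesis by linarith
    qed
    also have "\<dots> = (q * norm x)\<^sup>2"
      by (simp add: power_mult_distrib q(3) power2_norm_eq_inner algebra_simps)
    finally show "norm (C x) \<le> q * norm x"
      using q(1) by (simp add: abs_le_square_iff flip: power2_le_imp_le)
  qed
  define S where "S = {X :: (real^'n) \<Rightarrow>\<^sub>L (real^'n). norm X \<le> q \<and> (\<forall>x y. x \<bullet> blinfun_apply X y = blinfun_apply X x \<bullet> y)}"
  define F :: "((real^'n) \<Rightarrow>\<^sub>L (real^'n)) \<Rightarrow> _" where "F X = (1/2) *\<^sub>R (C + (X o\<^sub>L X))" for X
  have Cadj: "x \<bullet> C y = C x \<bullet> y" for x y
    by (simp add: C inner_diff_left inner_diff_right sym_pos_def_inner[OF A])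
  have "\<exists>!X\<in>S. F X = X"
  proof (rule Banach_fix[OF _ _ q(1,2)])
    have "closed S"
      unfolding S_def
      by (intro closed_Collect_conj closed_Collect_all closed_Collect_le closed_Collect_eq continuous_intros)
    then show "Topological_Spaces.complete S" by (simp add: complete_eq_closed)
    have "0 \<in> S" using q by (simp add: S_def)
    then show "S \<noteq> {}" by blast
    show "F ` S \<subseteq> S"
    proof safe
      fix X assume X: "X \<in> S"
      have "norm (F X) \<le> (1/2) * (norm C + norm (X o\<^sub>L X))"
        using norm_triangle_ineq[of C "X o\<^sub>L X"] by (simp add: F_def)
      also have "\<dots> \<le> (1/2) * (q + q * q)"
        using X normC norm_blinfun_compose[of X X] mult_mono[of "norm X" q "norm X" q] q by (auto simp: S_def)
      also have "\<dots> \<le> q" using q mult_left_le[of q q] by simp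
      finally have "norm (F X) \<le> q" .
      moreover have "x \<bullet> F X y = F X x \<bullet> y" for x y
        using X by (simp add: F_def S_def blinfun.bilinear_simps inner_add_left inner_add_right Cadj)
      ultimately show "F X \<in> S" by (simp add: S_def)
    qed
    fix X Y assume X: "X \<in> S" and Y: "Y \<in> S"
    have "F X - F Y = (1/2) *\<^sub>R ((X o\<^sub>L (X - Y)) + ((X - Y) o\<^sub>L Y))"
      by (rule blinfun_eqI) (simp add: F_def blinfun.bilinear_simps algebra_simps)
    then have "norm (F X - F Y) \<le> (1/2) * (norm (X o\<^sub>L (X - Y)) + norm ((X - Y) o\<^sub>L Y))"
      using norm_triangle_ineq[of "X o\<^sub>L (X - Y)" "(X - Y) o\<^sub>L Y"] by simp
    also have "\<dots> \<le> (1/2) * (q * norm (X - Y) + norm (X - Y) * q)"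
    proof -
      have "norm (X o\<^sub>L (X - Y)) \<le> q * norm (X - Y)"
        using X norm_blinfun_compose[of X "X - Y"] mult_right_mono[of "norm X" q "norm (X - Y)"]
        by (auto simp: S_def)
      moreover have "norm ((X - Y) o\<^sub>L Y) \<le> norm (X - Y) * q"
        using Y norm_blinfun_compose[of "X - Y" Y] mult_left_mono[of "norm Y" q "norm (X - Y)"]
        by (auto simp: S_def)
      ultimately show ?thesis by (intro mult_left_mono add_mono) auto
    qed
    finally show "dist (F X) (F Y) \<le> q * dist X Y" by (simp add: dist_norm mult.commute)
  qed
  then obtain X where X: "X \<in> S" "F X = X" by blast
  define h where "h x = sqrt c *\<^sub>R (x - X x)" for x
  have lin: "linear h"
    unfolding h_def by (intro bounded_linear.linear bounded_linear_intros)
  define B where "B = matrix h"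
  have Bv: "B *v x = h x" for x
    unfolding B_def using lin by (simp add: matrix_vector_mul)
  have fix2: "X (X x) = 2 *\<^sub>R X x - C x" for x
  proof -
    have "X x = F X x" by (simp add: X(2))
    then have "2 *\<^sub>R X x = 2 *\<^sub>R ((1/2) *\<^sub>R (C x + X (X x)))"
      by (simp add: F_def blinfun.bilinear_simps)
    then have "2 *\<^sub>R X x = C x + X (X x)" by (simp only: scaleR_scaleR) simp
    then show ?thesis by simp
  qed
  have "B ** B = A"
    using c(1) by (simp add: matrix_eq Bv h_def blinfun.bilinear_simps fix2 C flip: matrix_vector_mul_assoc)
      (simp add: algebra_simps scaleR_2)
  moreover have "sym_pos_def B"
    unfolding sym_pos_def_def
  proof safe
    have adj: "x \<bullet> (B *v y) = (B *v x) \<bullet> y" for x y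
      using X(1) by (simp add: Bv h_def S_def inner_diff_left inner_diff_right)
    show "transpose B = B"
    proof -
      have "(transpose B *v y) \<bullet> x = (B *v y) \<bullet> x" for x y
        by (simp only: transpose_matrix_vector dot_lmul_matrix adj)
      then show ?thesis by (metis matrix_eq vector_eq_rdot)
    qed
    fix x :: "real^'n" assume "x \<noteq> 0"
    have "x \<bullet> X x \<le> norm x * norm (X x)" by (rule norm_cauchy_schwarz)
    also have "\<dots> \<le> norm x * (q * norm x)"
      using X(1) norm_blinfun[of X x] mult_right_mono[of "norm X" q "norm x"]
      by (intro mult_left_mono) (auto simp: S_def)
    also have "\<dots> < norm x * norm x"
      using \<open>x \<noteq> 0\<close> q by (simp add: mult_less_cancel_right)
    finally have "x \<bullet> X x < x \<bullet> x" by (simp add: power2_eq_square dot_square_norm)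
    then show "0 < x \<bullet> (B *v x)" using c(1) by (simp add: Bv h_def inner_diff_right)
  qed
  ultimately show ?thesis by blast
qed

lemma trace_eq_sum_axis: "trace A = (\<Sum>i\<in>UNIV. axis i 1 \<bullet> (A *v axis i (1::real)))"
  by (simp add: trace_def inner_axis' matrix_vector_mult_basis column_def)

text \<open>With \<open>D = B - C\<close> the hypothesis gives \<open>B D + D C = 0\<close>. Multiplying by \<open>D\<close> and taking traces yields
  \<open>trace (D B D) + trace (D C D) = 0\<close>; both traces are sums of nonnegative quadratic forms in the columns of \<open>D\<close>,
  so these columns vanish.\<close>

lemma sym_pos_def_sqrt_unique:
  fixes B C :: "real^'n^'n"
  assumes B: "sym_pos_def B" and C: "sym_pos_def C" and eq: "B ** B = C ** C"
  shows "B = C"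
proof -
  define D where "D = B - C"
  have Dadj: "x \<bullet> (D *v y) = (D *v x) \<bullet> y" for x y
    by (simp add: D_def matrix_vector_mult_diff_rdistrib inner_diff_left inner_diff_right
        sym_pos_def_inner[OF B] sym_pos_def_inner[OF C])
  have 0: "B ** D + D ** C = 0"
  proof -
    have "B *v (D *v x) + D *v (C *v x) = (B ** B) *v x - (C ** C) *v x" for x
      by (simp add: D_def matrix_vector_mult_diff_rdistrib matrix_vector_mult_diff_distrib flip: matrix_vector_mul_assoc)
    then show ?thesis
      by (simp add: matrix_eq matrix_vector_mult_add_rdistrib eq flip: matrix_vector_mul_assoc)
  qed
  have tr: "trace (D ** (A ** D)) = (\<Sum>i\<in>UNIV. (D *v axis i 1) \<bullet> (A *v (D *v axis i 1)))" for A
    by (simp add: trace_eq_sum_axis Dadj flip: matrix_vector_mul_assoc)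
  have "0 = trace (D ** (B ** D + D ** C))" by (simp add: 0 trace_def)
  also have "\<dots> = trace (D ** (B ** D)) + trace (D ** (D ** C))"
    by (simp add: matrix_add_ldistrib trace_add)
  also have "trace (D ** (D ** C)) = trace (D ** (C ** D))"
    using trace_mul_sym[of D "D ** C"] by (simp add: matrix_mul_assoc)
  finally have sum0: "(\<Sum>i\<in>UNIV. (D *v axis i 1) \<bullet> (B *v (D *v axis i 1))) + (\<Sum>i\<in>UNIV. (D *v axis i 1) \<bullet> (C *v (D *v axis i 1))) = 0"
    by (simp add: tr)
  have "(\<Sum>i\<in>UNIV. (D *v axis i 1) \<bullet> (B *v (D *v axis i 1))) = 0"
    using sum0 sum_nonneg[of UNIV "\<lambda>i. (D *v axis i 1) \<bullet> (B *v (D *v axis i 1))"]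
      sum_nonneg[of UNIV "\<lambda>i. (D *v axis i 1) \<bullet> (C *v (D *v axis i 1))"]
      sym_pos_def_nonneg[OF B] sym_pos_def_nonneg[OF C] by force
  then have "D *v axis i 1 = 0" for i
    using sym_pos_def_pos[OF B, of "D *v axis i 1"]
    by (subst (asm) sum_nonneg_eq_0_iff) (auto simp: sym_pos_def_nonneg[OF B] dest: spec[of _ i])
  then have "D = 0"
    by (simp add: vec_eq_iff matrix_vector_mult_basis column_def)
  then show ?thesis by (simp add: D_def)
qed

lemma matrix_sqrt:
  assumes "sym_pos_def A"
  shows sym_pos_def_matrix_sqrt: "sym_pos_def (matrix_sqrt A)"
    and matrix_sqrt_square: "matrix_sqrt A ** matrix_sqrt A = A"
proof -
  have "\<exists>!B. sym_pos_def B \<and> B ** B = A"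
    using sym_pos_def_sqrt_exists[OF assms] sym_pos_def_sqrt_unique by metis
  from theI'[OF this] show "sym_pos_def (matrix_sqrt A)" "matrix_sqrt A ** matrix_sqrt A = A"
    by (simp_all add: matrix_sqrt_def)
qed

section \<open>Marginals of the Gaussian distribution\<close>

lemma matrix_inv:
  assumes "invertible A"
  shows matrix_inv_left: "matrix_inv A ** A = mat 1"
    and matrix_inv_right: "A ** matrix_inv A = mat 1"
  using assms someI_ex[of "\<lambda>B. A ** B = mat 1 \<and> B ** A = mat 1"]
  by (auto simp: invertible_def matrix_inv_def)

lemma nn_integral_lborel_affine:
  fixes M :: "real^'n^'n"
  assumes [measurable]: "h \<in> borel_measurable borel" and M: "det M \<noteq> 0"
  shows "(\<integral>\<^sup>+y. h y \<partial>lborel) = (\<integral>\<^sup>+w. ennreal \<bar>det M\<bar> * h (m + M *v w) \<partial>lborel)"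
proof -
  have "lborel = density (distr lborel borel ((*v) M)) (\<lambda>_. ennreal \<bar>det M\<bar>)"
    by (rule measure_eqI)
      (auto simp: emeasure_density nn_integral_cmult emeasure_distr emeasure_vimage_matrix[OF M])
  then have "(\<integral>\<^sup>+y. h (m + y) \<partial>lborel)
      = (\<integral>\<^sup>+y. h (m + y) \<partial>density (distr lborel borel ((*v) M)) (\<lambda>_. ennreal \<bar>det M\<bar>))"
    by simp
  also have "\<dots> = (\<integral>\<^sup>+w. ennreal \<bar>det M\<bar> * h (m + M *v w) \<partial>lborel)"
    by (simp add: nn_integral_density nn_integral_distr)
  finally show ?thesis by (simp add: nn_integral_lborel_translate)
qed

lemma std_normal_density_prod:
  fixes w :: "real^'n"
  shows "(\<Prod>b\<in>Basis. std_normal_density (w \<bullet> b)) = exp (- (w \<bullet> w) / 2) / sqrt (2 * pi) ^ CARD('n)"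
proof -
  have "w \<bullet> w = (\<Sum>b\<in>Basis. (w \<bullet> b)\<^sup>2)"
    by (subst euclidean_inner) (simp add: power2_eq_square)
  then have "exp (- (w \<bullet> w) / 2) = (\<Prod>b\<in>Basis. exp (- (w \<bullet> b)\<^sup>2 / 2))"
    by (simp add: exp_sum[symmetric] sum_negf sum_divide_distrib)
  then show ?thesis
    by (simp add: std_normal_density_def prod.distrib prod_dividef power_one_over)
qed

text \<open>Let \<open>B\<close> be the square root of \<open>V\<close> and \<open>f\<close> an orthogonal map taking a coordinate vector to the direction of \<open>B x\<close>.
  Substituting \<open>y = m + B (f w)\<close> turns the Gaussian density into a product of standard normal densities, and the
  standardized functional \<open>x \<bullet> y\<close> into a single coordinate of \<open>w\<close>.\<close>

lemma gaussian_affine_marginal: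
  fixes x m :: "real^'n"
  assumes V: "sym_pos_def V" and x: "x \<noteq> 0"
  shows "distr (gaussian m V) borel (\<lambda>y. (x \<bullet> y - x \<bullet> m) / dual_norm V x) = std_normal_distribution"
proof -
  define B where "B = matrix_sqrt V"
  have B: "sym_pos_def B" "B ** B = V"
    unfolding B_def by (rule matrix_sqrt[OF V])+
  define s where "s = norm (B *v x)"
  have s: "s > 0" using x sym_pos_def_mult_eq_0_iff[OF B(1)] by (simp add: s_def)
  \<comment> \<open>Any coordinate will do.\<close>
  define k :: 'n where "k = undefined"
  have eqn: "norm (axis k 1 :: real^'n) = norm ((1 / s) *\<^sub>R (B *v x))"
    using s by (simp add: s_def norm_axis_1)
  obtain f :: "real^'n \<Rightarrow> real^'n"
    where f: "orthogonal_transformation f" "f (axis k 1) = (1 / s) *\<^sub>R (B *v x)"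
    by (rule orthogonal_transformation_exists[OF eqn])
  define M where "M = B ** matrix f"
  have linf: "linear f" using f(1) by (simp add: orthogonal_transformation_linear)
  have Mv: "M *v w = B *v f w" for w
    using linf by (simp add: M_def matrix_vector_mul flip: matrix_vector_mul_assoc)
  have detf: "\<bar>det (matrix f)\<bar> = 1"
    using f(1) by (simp add: orthogonal_transformation_det)
  have detB: "det B \<noteq> 0" using sym_pos_def_invertible[OF B(1)] by (simp add: invertible_det_nz)
  have detM: "\<bar>det M\<bar> = \<bar>det B\<bar>" by (simp add: M_def det_mul abs_mult detf)
  have detV: "det V = \<bar>det B\<bar> * \<bar>det B\<bar>" by (simp add: det_mul flip: B(2))
  have invV: "matrix_inv V *v (B *v (B *v z)) = z" for z
  proof -
    have "matrix_inv V ** V = mat 1"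
      using sym_pos_def_invertible[OF V] by (rule matrix_inv_left)
    then show ?thesis by (metis B(2) matrix_vector_mul_assoc matrix_vector_mul_lid)
  qed
  have surjB: "\<exists>z. v = B *v z" for v
    using sym_pos_def_invertible[OF B(1)] by (metis matrix_inv_right matrix_vector_mul_assoc matrix_vector_mul_lid)
  have quad: "(M *v w) \<bullet> (matrix_inv V *v (M *v w)) = w \<bullet> w" for w
  proof -
    obtain z where z: "f w = B *v z" using surjB by blast
    have "(M *v w) \<bullet> (matrix_inv V *v (M *v w)) = (B *v f w) \<bullet> z"
      by (simp add: Mv z invV)
    also have "\<dots> = f w \<bullet> f w"
      by (simp add: sym_pos_def_inner[OF B(1), symmetric] z)
    also have "\<dots> = w \<bullet> w" using f(1) by (simp add: orthogonal_transformation_def)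
    finally show ?thesis .
  qed
  have proj: "(x \<bullet> (m + M *v w) - x \<bullet> m) / s = w \<bullet> axis k 1" for w
  proof -
    have "x \<bullet> (M *v w) = (B *v x) \<bullet> f w" by (simp add: Mv sym_pos_def_inner[OF B(1)])
    also have "\<dots> = s * (f (axis k 1) \<bullet> f w)" using s by (simp add: f(2))
    also have "\<dots> = s * (w \<bullet> axis k 1)" using f(1) by (simp add: orthogonal_transformation_def inner_commute)
    finally show ?thesis using s by (simp add: inner_add_right)
  qed
  define dens where "dens y = exp (- ((y - m) \<bullet> (matrix_inv V *v (y - m))) / 2)
        / sqrt ((2 * pi) ^ CARD('n) * det V)" for y
  have [measurable]: "dens \<in> borel_measurable borel"
    unfolding dens_def by measurable
  have gauss: "gaussian m V = density lborel (\<lambda>y. ennreal (dens y))"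
    by (simp only: gaussian_def dens_def)
  have dens: "\<bar>det M\<bar> * dens (m + M *v w) = (\<Prod>b\<in>Basis. std_normal_density (w \<bullet> b))" for w
    using detB by (simp add: dens_def quad std_normal_density_prod detM detV real_sqrt_mult real_sqrt_power power_mult_distrib)
  show ?thesis
  proof (rule measure_eqI)
    fix S assume "S \<in> sets (distr (gaussian m V) borel (\<lambda>y. (x \<bullet> y - x \<bullet> m) / dual_norm V x))"
    then have S[measurable]: "S \<in> sets borel" by simp
    define p where "p y = (x \<bullet> y - x \<bullet> m) / s" for y
    have [measurable]: "p \<in> borel_measurable borel" unfolding p_def by measurable
    have "p -` S \<in> sets borel"
      using measurable_sets[of p borel borel S] by simp
    then have "emeasure (distr (gaussian m V) borel p) S = (\<integral>\<^sup>+y. ennreal (dens y) * indicator S (p y) \<partial>lborel)"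
      by (simp add: gauss emeasure_distr emeasure_density indicator_vimage[symmetric])
    also have "\<dots> = (\<integral>\<^sup>+w. ennreal \<bar>det M\<bar> * (ennreal (dens (m + M *v w)) * indicator S (p (m + M *v w))) \<partial>lborel)"
      by (rule nn_integral_lborel_affine) (use detM detB in auto)
    also have "\<dots> = (\<integral>\<^sup>+w. (\<Prod>b\<in>(Basis::(real^'n) set). ennreal (std_normal_density (w \<bullet> b)) * (if b = axis k 1 then indicator S (w \<bullet> b) else 1)) \<partial>lborel)"
    proof (rule nn_integral_cong)
      fix w :: "real^'n"
      have "ennreal \<bar>det M\<bar> * (ennreal (dens (m + M *v w)) * indicator S (p (m + M *v w)))
          = ennreal (\<Prod>b\<in>Basis. std_normal_density (w \<bullet> b)) * indicator S (w \<bullet> axis k 1)"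
        by (simp add: p_def proj dens[symmetric] ennreal_mult' mult.assoc)
      also have "\<dots> = (\<Prod>b\<in>Basis. ennreal (std_normal_density (w \<bullet> b)) * (if b = axis k 1 then indicator S (w \<bullet> b) else 1))"
        by (simp add: prod.distrib prod_ennreal prod.delta)
      finally show "ennreal \<bar>det M\<bar> * (ennreal (dens (m + M *v w)) * indicator S (p (m + M *v w)))
         = (\<Prod>b\<in>Basis. ennreal (std_normal_density (w \<bullet> b)) * (if b = axis k 1 then indicator S (w \<bullet> b) else 1))" .
    qed
    also have "\<dots> = (\<Prod>b\<in>(Basis::(real^'n) set). \<integral>\<^sup>+t. ennreal (std_normal_density t) * (if b = axis k 1 then indicator S t else 1) \<partial>lborel)"
      by (rule nn_integral_lborel_prod) auto
    also have "\<dots> = (\<Prod>b\<in>(Basis::(real^'n) set). if b = axis k 1 then emeasure std_normal_distribution S else 1)"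
    proof (rule prod.cong)
      have "emeasure std_normal_distribution (space std_normal_distribution) = 1"
        using prob_space_normal_density[of 1 0] by (intro prob_space.emeasure_space_1) simp
      then have "(\<integral>\<^sup>+t. ennreal (std_normal_density t) \<partial>lborel) = 1"
        by (simp add: emeasure_density)
      then show "(\<integral>\<^sup>+t. ennreal (std_normal_density t) * (if b = axis k 1 then indicator S t else 1) \<partial>lborel)
          = (if b = axis k 1 then emeasure std_normal_distribution S else 1)" for b :: "real^'n"
        by (simp add: emeasure_density)
    qed simp
    also have "\<dots> = emeasure std_normal_distribution S" by (simp add: prod.delta)
    finally show "emeasure (distr (gaussian m V) borel (\<lambda>y. (x \<bullet> y - x \<bullet> m) / dual_norm V x)) S
        = emeasure std_normal_distribution S"
      by (simp add: p_def[abs_def] dual_norm_def s_def B_def)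
  qed simp
qed

section \<open>The standard normal distribution function\<close>

interpretation std_normal: real_distribution std_normal_distribution
  by (rule real_dist_normal_dist)

lemma std_normal_singleton: "measure std_normal_distribution {x} = 0"
proof -
  have "emeasure std_normal_distribution {x} = 0"
    using AE_lborel_singleton[of x]
    by (subst emeasure_density) (auto simp: nn_integral_0_iff_AE elim!: eventually_mono)
  then show ?thesis by (simp add: measure_def)
qed

lemma isCont_Phi: "isCont Phi x"
  by (simp add: std_normal.isCont_cdf std_normal_singleton)

lemma continuous_on_Phi: "continuous_on A Phi"
  by (simp add: continuous_at_imp_continuous_on isCont_Phi)

lemma Phi_mono: "x \<le> y \<Longrightarrow> Phi x \<le> Phi y"
  by (rule std_normal.cdf_nondecreasing)

lemma measure_std_normal_atLeastAtMost:
  assumes "a \<le> b" shows "measure std_normal_distribution {a..b} = Phi b - Phi a"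
proof -
  have "{a..b} = {a<..b} \<union> {a}" using assms by auto
  then have "measure std_normal_distribution {a..b} = measure std_normal_distribution {a<..b}"
    using std_normal.finite_measure_Union[of "{a<..b}" "{a}"] by (simp add: std_normal_singleton)
  then show ?thesis using std_normal.cdf_diff_eq[of a b] assms by (cases "a = b") auto
qed

lemma measure_std_normal_greaterThanLessThan:
  assumes "a \<le> b" shows "measure std_normal_distribution {a<..<b} = Phi b - Phi a"
proof (cases "a = b")
  case False
  then have "{a<..b} = {a<..<b} \<union> {b}" using assms by auto
  then have "measure std_normal_distribution {a<..b} = measure std_normal_distribution {a<..<b}"
    using std_normal.finite_measure_Union[of "{a<..<b}" "{b}"] by (simp add: std_normal_singleton)
  then show ?thesis using std_normal.cdf_diff_eq[of a b] assms False by auto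
qed simp

lemma has_real_derivative_std_normal_density:
  "(std_normal_density has_real_derivative - x * std_normal_density x) (at x)"
proof -
  have "((\<lambda>x. c * exp (- x\<^sup>2 / 2)) has_real_derivative - x * (c * exp (- x\<^sup>2 / 2))) (at x)" for c :: real
    by (auto intro!: derivative_eq_intros)
  from this[of "1 / sqrt (2 * pi)"] show ?thesis by (simp add: std_normal_density_def[abs_def])
qed

lemma has_real_derivative_Phi: "(Phi has_real_derivative std_normal_density x) (at x)"
proof -
  define a where "a = x - 1"
  have cont: "continuous_on A std_normal_density" for A
    using has_real_derivative_std_normal_density DERIV_isCont by (blast intro: continuous_at_imp_continuous_on)
  have Phi_eq: "Phi y = Phi a + integral {a..y} std_normal_density" if "y \<in> {a..x+1}" for y
  proof -
    have "Phi y - Phi a = (LINT t|std_normal_distribution. indicator {a..y} t)"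
      using that by (simp add: measure_std_normal_atLeastAtMost)
    also have "\<dots> = (LINT t:{a..y}|lborel. std_normal_density t)"
      by (subst integral_real_density) (auto simp: set_lebesgue_integral_def mult.commute)
    also have "\<dots> = integral {a..y} std_normal_density"
      by (rule set_borel_integral_eq_integral)
        (intro borel_integrable_atLeastAtMost' cont)
    finally show ?thesis by simp
  qed
  have "((\<lambda>y. integral {a..y} std_normal_density) has_real_derivative std_normal_density x) (at x within {a..x+1})"
    by (rule integral_has_real_derivative) (auto simp: a_def cont)
  then have "((\<lambda>y. Phi a + integral {a..y} std_normal_density) has_real_derivative std_normal_density x) (at x within {a..x+1})"
    by (auto intro!: derivative_eq_intros)
  then have "(Phi has_real_derivative std_normal_density x) (at x within {a..x+1})"
    unfolding has_field_derivative_def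
    by (rule has_derivative_transform[rotated 2]) (auto simp: a_def intro!: Phi_eq[unfolded a_def])
  then show ?thesis
    by (simp add: a_def at_within_Icc_at)
qed

lemma Phi_0: "Phi 0 = 1 / 2"
proof -
  have "emeasure std_normal_distribution {..0} = (\<integral>\<^sup>+x. ennreal (std_normal_density x) * indicator {..0} x \<partial>lborel)"
    by (simp add: emeasure_density)
  also have "\<dots> = (\<integral>\<^sup>+x. ennreal (std_normal_density x) * indicator {0..} x \<partial>lborel)"
    by (subst nn_integral_real_affine[where c = "-1" and t = 0])
      (auto simp: std_normal_density_def indicator_def intro!: nn_integral_cong)
  also have "\<dots> = emeasure std_normal_distribution {0..}"
    by (simp add: emeasure_density)
  finally have eq: "measure std_normal_distribution {..0} = measure std_normal_distribution {0..}"
    by (simp add: measure_def)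
  have "{0::real..} = {0} \<union> (space std_normal_distribution - {..0})" by auto
  then have "measure std_normal_distribution {0..} = 1 - measure std_normal_distribution {..0}"
    using std_normal.finite_measure_Union[of "{0}" "space std_normal_distribution - {..0}"]
      std_normal.prob_compl[of "{..0}"] by (simp add: std_normal_singleton)
  then show ?thesis using eq by (simp add: cdf_def)
qed

text \<open>The density increases on the negative axis and decreases on the positive one; \<open>\<epsilon> < 1 / 2\<close> will keep all arguments
  of \<open>Phi\<close> on the side where its curvature has the favourable sign.\<close>

lemma Phi_convex: "convex_on {..0} Phi"
  by (rule f''_ge0_imp_convex[where f' = std_normal_density and f'' = "\<lambda>x. - x * std_normal_density x"])
    (simp_all only: has_real_derivative_Phi has_real_derivative_std_normal_density convex_real_interval,
     simp add: mult_nonpos_nonneg)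

lemma Phi_concave: "convex_on {0..} (\<lambda>x. - Phi x)"
  by (rule f''_ge0_imp_convex[where f' = "\<lambda>x. - std_normal_density x" and f'' = "\<lambda>x. x * std_normal_density x"])
    (auto intro!: derivative_eq_intros has_real_derivative_Phi has_real_derivative_std_normal_density convex_real_interval)

section \<open>Core mass and the function g\<close>

text \<open>The difference of distribution values, which is negative when the interval shrunk by \<open>t\<close> on both sides is empty;
  unlike the probability itself it stays monotone, continuous and, in the right range, jointly concave.\<close>

definition core_mass :: "real \<Rightarrow> real \<Rightarrow> real \<Rightarrow> real" where
  "core_mass l u t = Phi (u - t) - Phi (l + t)"

text \<open>The distance of \<open>z\<close> to the complement of the interval, that is, the cost of moving a unit mass from \<open>z\<close> out of it.\<close>

definition depth :: "real \<Rightarrow> real \<Rightarrow> real \<Rightarrow> real" where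
  "depth l u z = max 0 (min (z - l) (u - z))"

lemma core_mass_antimono: "s \<le> t \<Longrightarrow> core_mass l u t \<le> core_mass l u s"
  unfolding core_mass_def by (intro diff_mono Phi_mono) auto

lemma core_mass_mono: "l' \<le> l \<Longrightarrow> u \<le> u' \<Longrightarrow> core_mass l u t \<le> core_mass l' u' t"
  unfolding core_mass_def by (intro diff_mono Phi_mono) auto

lemma continuous_core_mass: "continuous_on A (core_mass l u)"
  unfolding core_mass_def[abs_def]
  by (intro continuous_on_diff continuous_on_compose2[OF continuous_on_Phi[of UNIV]] continuous_intros) auto

lemma core_mass_nonpos: "u - l \<le> 2 * t \<Longrightarrow> core_mass l u t \<le> 0"
  unfolding core_mass_def using Phi_mono[of "u - t" "l + t"] by simp

lemma core_mass_integrable: "(\<lambda>t. core_mass l u t - c) integrable_on {a..b::real}"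
  by (intro integrable_continuous_real continuous_intros continuous_core_mass)

lemma excess_integrable: "(\<lambda>t. max (core_mass l u t - c) 0) integrable_on {a..b::real}"
  by (intro integrable_continuous_real continuous_intros continuous_core_mass)

lemma g_eq_integral:
  assumes "\<epsilon> < 1" "0 \<le> S" "u - l \<le> 2 * S"
  shows "g \<epsilon> l u = integral {0..S} (\<lambda>t. max (core_mass l u t - (1 - \<epsilon>)) 0)"
proof -
  have 0: "max (core_mass l u t - (1 - \<epsilon>)) 0 = 0" if "t > S" for t
    using core_mass_nonpos[of u l t] that assms by simp
  have "g \<epsilon> l u = (LINT t:{0..}|lborel. max (core_mass l u t - (1 - \<epsilon>)) 0)"
    by (simp add: g_def core_mass_def algebra_simps)
  also have "\<dots> = (LINT t:{0..S}|lborel. max (core_mass l u t - (1 - \<epsilon>)) 0)"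
    unfolding set_lebesgue_integral_def
    using 0 assms(2) by (intro Bochner_Integration.integral_cong) (auto simp: indicator_def)
  also have "\<dots> = integral {0..S} (\<lambda>t. max (core_mass l u t - (1 - \<epsilon>)) 0)"
    by (intro set_borel_integral_eq_integral borel_integrable_atLeastAtMost' continuous_intros continuous_core_mass)
  finally show ?thesis .
qed

text \<open>The integrand of \<open>g\<close> is a positive part, so any truncated integral of the unclipped excess is a lower bound. Equality
  holds at a crossing point, where the core mass equals \<open>1 - \<epsilon>\<close>: this bound serves to construct violating distributions,
  the equality to exclude them.\<close>

lemma g_ge_integral:
  assumes "\<epsilon> < 1" "0 \<le> s"
  shows "integral {0..s} (\<lambda>t. core_mass l u t - (1 - \<epsilon>)) \<le> g \<epsilon> l u"
proof -
  define S where "S = max s (u - l)"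
  have S: "0 \<le> S" "u - l \<le> 2 * S" "s \<le> S" using assms by (auto simp: S_def max_def)
  have "integral {0..s} (\<lambda>t. core_mass l u t - (1 - \<epsilon>)) \<le> integral {0..s} (\<lambda>t. max (core_mass l u t - (1 - \<epsilon>)) 0)"
    by (intro integral_le core_mass_integrable excess_integrable) auto
  also have "\<dots> \<le> integral {0..S} (\<lambda>t. max (core_mass l u t - (1 - \<epsilon>)) 0)"
    using S by (intro integral_subset_le excess_integrable) auto
  finally show ?thesis by (simp add: g_eq_integral[OF assms(1) S(1,2)])
qed

lemma g_eq_integral_crossing:
  assumes "\<epsilon> < 1" "0 \<le> s" "core_mass l u s = 1 - \<epsilon>"
  shows "g \<epsilon> l u = integral {0..s} (\<lambda>t. core_mass l u t - (1 - \<epsilon>))"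
proof -
  define S where "S = max s (u - l)"
  have S: "0 \<le> S" "u - l \<le> 2 * S" "s \<le> S" using assms by (auto simp: S_def max_def)
  have "g \<epsilon> l u = integral {0..S} (\<lambda>t. max (core_mass l u t - (1 - \<epsilon>)) 0)"
    by (rule g_eq_integral[OF assms(1) S(1,2)])
  also have "\<dots> = integral {0..s} (\<lambda>t. max (core_mass l u t - (1 - \<epsilon>)) 0) + integral {s..S} (\<lambda>t. max (core_mass l u t - (1 - \<epsilon>)) 0)"
    using S assms(2) by (intro Henstock_Kurzweil_Integration.integral_combine[symmetric] excess_integrable) auto
  also have "integral {s..S} (\<lambda>t. max (core_mass l u t - (1 - \<epsilon>)) 0) = integral {s..S} (\<lambda>t. 0)"
    by (rule integral_cong) (use core_mass_antimono[of s _ l u] assms(3) in auto)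
  also have "integral {0..s} (\<lambda>t. max (core_mass l u t - (1 - \<epsilon>)) 0) = integral {0..s} (\<lambda>t. core_mass l u t - (1 - \<epsilon>))"
    by (rule integral_cong) (use core_mass_antimono[of _ s l u] assms(3) in auto)
  finally show ?thesis by simp
qed

lemma core_mass_0_le_imp_g_eq_0:
  assumes "\<epsilon> < 1" "core_mass l u 0 \<le> 1 - \<epsilon>"
  shows "g \<epsilon> l u = 0"
proof -
  define S where "S = max 0 (u - l)"
  have "g \<epsilon> l u = integral {0..S} (\<lambda>t. max (core_mass l u t - (1 - \<epsilon>)) 0)"
    by (rule g_eq_integral[OF assms(1)]) (auto simp: S_def max_def)
  also have "\<dots> = integral {0..S} (\<lambda>t. 0)"
    by (rule integral_cong) (use core_mass_antimono[of 0 _ l u] assms(2) in \<open>force simp: max_def\<close>)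
  finally show ?thesis by simp
qed

lemma core_mass_crossing:
  assumes "0 \<le> c" "c \<le> core_mass l u 0"
  obtains s where "0 \<le> s" "2 * s \<le> max 0 (u - l)" "core_mass l u s = c"
proof -
  define S where "S = max 0 (u - l) / 2"
  have "\<exists>s\<ge>0. s \<le> S \<and> core_mass l u s = c"
    using core_mass_nonpos[of u l S] assms
    by (intro IVT2') (auto simp: S_def continuous_core_mass)
  then show ?thesis using that by (auto simp: S_def)
qed

lemma g_pos_crossing:
  assumes "0 < \<epsilon>" "\<epsilon> < 1" "0 < g \<epsilon> l u"
  obtains s where "0 < s" "2 * s \<le> u - l" "core_mass l u s = 1 - \<epsilon>"
proof -
  have gt: "core_mass l u 0 > 1 - \<epsilon>"
    using core_mass_0_le_imp_g_eq_0[OF assms(2), of l u] assms(3) by force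
  then obtain s where s: "0 \<le> s" "2 * s \<le> max 0 (u - l)" "core_mass l u s = 1 - \<epsilon>"
    using core_mass_crossing[of "1 - \<epsilon>" l u] assms by auto
  have "s \<noteq> 0" using gt s by auto
  with s show ?thesis by (intro that[of s]) auto
qed

lemma measurable_depth [measurable]: "depth l u \<in> borel_measurable borel"
  unfolding depth_def[abs_def] by measurable

lemma less_depth_iff: "0 \<le> t \<Longrightarrow> t < depth l u z \<longleftrightarrow> l + t < z \<and> z < u - t"
  by (auto simp: depth_def)

lemma measure_less_depth:
  assumes "0 \<le> t" "2 * t \<le> u - l"
  shows "measure std_normal_distribution {z. t < depth l u z} = core_mass l u t"
proof -
  have "{z. t < depth l u z} = {l+t<..<u-t}" using less_depth_iff[OF assms(1)] by auto
  then show ?thesis using assms by (simp add: core_mass_def measure_std_normal_greaterThanLessThan)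
qed

text \<open>Layer cake: \<open>min (depth l u z) s\<close> is the length of the set of those \<open>t\<close> in \<open>{0..s}\<close> with \<open>t < depth l u z\<close>, and the mass
  of depth greater than \<open>t\<close> is the core mass.\<close>

lemma nn_integral_min_depth:
  assumes "0 \<le> s" "2 * s \<le> u - l"
  shows "(\<integral>\<^sup>+z. ennreal (min (depth l u z) s) \<partial>std_normal_distribution) = ennreal (integral {0..s} (core_mass l u))"
proof -
  interpret pair_sigma_finite std_normal_distribution lborel ..
  have [measurable]: "{t. t < depth l u z} \<in> sets borel" for z
    by measurable
  have layer: "ennreal (min (depth l u z) s) = (\<integral>\<^sup>+t. indicator {0..s} t * indicator {t. t < depth l u z} t \<partial>lborel)" for z
  proof -
    have "(\<integral>\<^sup>+t. indicator {0..s} t * indicator {t. t < depth l u z} t \<partial>lborel)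
        = (\<integral>\<^sup>+t. indicator ({0..s} \<inter> {t. t < depth l u z}) t \<partial>lborel)"
      by (simp only: indicator_inter_arith)
    also have "\<dots> = emeasure lborel ({0..s} \<inter> {t. t < depth l u z})"
      by (rule nn_integral_indicator) simp
    also have "{0..s} \<inter> {t. t < depth l u z} = (if depth l u z \<le> s then {0..<depth l u z} else {0..s})"
      by auto
    also have "emeasure lborel \<dots> = ennreal (min (depth l u z) s)"
      using assms(1) by (auto simp: depth_def min_def)
    finally show ?thesis by simp
  qed
  have "(\<integral>\<^sup>+z. ennreal (min (depth l u z) s) \<partial>std_normal_distribution)
      = (\<integral>\<^sup>+z. (\<integral>\<^sup>+t. indicator {0..s} t * indicator {t. t < depth l u z} t \<partial>lborel) \<partial>std_normal_distribution)"
    by (simp only: layer)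
  also have "\<dots> = (\<integral>\<^sup>+t. (\<integral>\<^sup>+z. indicator {0..s} t * indicator {t. t < depth l u z} t \<partial>std_normal_distribution) \<partial>lborel)"
    by (rule Fubini'[symmetric]) measurable
  also have "\<dots> = (\<integral>\<^sup>+t. ennreal (core_mass l u t) * indicator {0..s} t \<partial>lborel)"
  proof (rule nn_integral_cong)
    fix t :: real
    show "(\<integral>\<^sup>+z. indicator {0..s} t * indicator {t. t < depth l u z} t \<partial>std_normal_distribution)
        = ennreal (core_mass l u t) * indicator {0..s} t"
    proof (cases "t \<in> {0..s}")
      case True
      have "(\<integral>\<^sup>+z. indicator {0..s} t * indicator {t. t < depth l u z} t \<partial>std_normal_distribution)
         = (\<integral>\<^sup>+z. indicator {z. t < depth l u z} z \<partial>std_normal_distribution)"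
        using True by (intro nn_integral_cong) (auto simp: indicator_def)
      also have "\<dots> = emeasure std_normal_distribution {z. t < depth l u z}"
        by (rule nn_integral_indicator) simp
      also have "\<dots> = ennreal (core_mass l u t)"
        using True assms by (subst std_normal.emeasure_eq_measure, subst measure_less_depth) auto
      finally show ?thesis using True by simp
    qed simp
  qed
  also have "\<dots> = (\<integral>\<^sup>+t. ennreal (indicator {0..s} t * core_mass l u t) \<partial>lborel)"
    by (intro nn_integral_cong) (simp add: indicator_def)
  also have "\<dots> = ennreal (integral {0..s} (core_mass l u))"
  proof (rule nn_integral_has_integral_lebesgue)
    show "core_mass l u t \<ge> 0" if "t \<in> {0..s}" for t
      using that assms Phi_mono[of "l+t" "u-t"] by (auto simp: core_mass_def)
    show "(core_mass l u has_integral integral {0..s} (core_mass l u)) {0..s}"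
      using core_mass_integrable[of l u 0] by (simp add: integrable_integral)
  qed
  finally show ?thesis .
qed

section \<open>Robust chance constraints and their worst case\<close>

lemma ennreal_le_diff:
  assumes "a + ennreal x \<le> ennreal y" "0 \<le> x"
  shows "a \<le> ennreal (y - x)"
proof (cases a)
  case (real r)
  then show ?thesis using assms by (auto simp: ennreal_plus[symmetric] ennreal_le_iff2 simp del: ennreal_plus intro!: ennreal_leI)
qed (use assms in \<open>simp add: top_unique\<close>)

lemma ennreal_diff_le:
  assumes "ennreal y \<le> a + ennreal x" "0 \<le> x"
  shows "ennreal (y - x) \<le> a"
proof (cases a)
  case (real r)
  then show ?thesis using assms by (auto simp: ennreal_plus[symmetric] ennreal_le_iff2 simp del: ennreal_plus intro!: ennreal_leI)
qed simp

lemma integral_core_mass_diff: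
  assumes "0 \<le> s"
  shows "integral {0..s} (\<lambda>t. core_mass l u t - c) = integral {0..s} (core_mass l u) - s * c"
  using core_mass_integrable[of l u 0 0 s] assms
  by (subst integral_diff) auto

lemma depth_le_dist: "x < l \<or> u < x \<Longrightarrow> depth l u z \<le> \<bar>x - z\<bar>"
  by (auto simp: depth_def)

text \<open>The common setting of the real line and of the Gaussian on \<open>real^'n\<close>: a functional \<open>b\<close> that is standard normal under the
  reference distribution and nonexpansive for \<open>N\<close>, and a direction \<open>v\<close> along which \<open>b\<close> moves at unit speed and unit cost.
  Nonexpansiveness bounds transport costs from below by those on the line; \<open>v\<close> lifts transports on the line at equal cost.\<close>

locale normal_projection = prob_space P for P :: "'a::euclidean_space measure" +
  fixes N :: "'a \<Rightarrow> real" and b :: "'a \<Rightarrow> real" and v :: 'a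
  assumes sets_P: "sets P = sets borel"
    and distr_b: "distr P borel b = std_normal_distribution"
    and b_meas [measurable]: "b \<in> borel_measurable borel"
    and N_meas [measurable]: "N \<in> borel_measurable borel"
    and b_le_N: "\<bar>b y - b y'\<bar> \<le> N (y - y')"
    and b_shift: "b (y + r *\<^sub>R v) = b y + r"
    and N_shift: "N (r *\<^sub>R v) = \<bar>r\<bar>"
begin

text \<open>Suppose \<open>b\<close> stays in the interval with \<open>Q\<close>-probability only \<open>p < 1 - \<epsilon>\<close>. Every coupling ends with mass \<open>1 - p\<close> outside the
  interval, and \<open>min (depth l u z) s \<le> N (x - y) + s * indicator E x\<close> bounds its cost from below by
  \<open>integral {0..s} (core_mass l u) - s * p\<close>. With \<open>s\<close> the point where the core mass equals \<open>1 - \<epsilon>\<close> this is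
  \<open>g \<epsilon> l u + s * (1 - \<epsilon> - p)\<close>, which exceeds \<open>\<delta>\<close> by an amount that does not depend on the coupling.\<close>

lemma measure_ge_if_g_ge:
  assumes "0 < \<epsilon>" "\<epsilon> < 1" "0 < \<delta>" "\<delta> \<le> g \<epsilon> l u"
    and Q: "Q \<in> wasserstein_ball N \<delta> P"
  shows "1 - \<epsilon> \<le> measure Q {y. l \<le> b y \<and> b y \<le> u}"
proof (rule ccontr)
  define E where "E = {y. l \<le> b y \<and> b y \<le> u}"
  have [measurable]: "E \<in> sets borel" unfolding E_def by measurable
  define p where "p = measure Q E"
  assume "\<not> 1 - \<epsilon> \<le> measure Q {y. l \<le> b y \<and> b y \<le> u}"
  then have p: "p < 1 - \<epsilon>" by (simp add: p_def E_def)
  obtain s where s: "0 < s" "2 * s \<le> u - l" "core_mass l u s = 1 - \<epsilon>"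
    using g_pos_crossing[of \<epsilon> l u] assms by auto
  have I: "integral {0..s} (core_mass l u) = g \<epsilon> l u + s * (1 - \<epsilon>)"
    using g_eq_integral_crossing[OF assms(2) _ s(3)] s(1) by (simp add: integral_core_mass_diff)
  have Qp: "prob_space Q" and Qs: "sets Q = sets borel" and W: "wasserstein N Q P \<le> ennreal \<delta>"
    using Q by (auto simp: wasserstein_ball_def)
  interpret Q: prob_space Q by (rule Qp)
  have low: "ennreal (g \<epsilon> l u + s * (1 - \<epsilon>) - s * p) \<le> (\<integral>\<^sup>+z. ennreal (N (fst z - snd z)) \<partial>\<pi>)"
    if "\<pi> \<in> couplings Q P" for \<pi>
  proof -
    have ps: "sets \<pi> = sets borel" and pQ: "distr \<pi> borel fst = Q" and pP: "distr \<pi> borel snd = P"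
      using that by (auto simp: couplings_def)
    have [measurable]: "h \<in> borel_measurable \<pi> \<longleftrightarrow> h \<in> borel_measurable borel" for h :: "'a \<times> 'a \<Rightarrow> 'b::topological_space"
      using ps by (metis measurable_cong_sets)
    have [measurable]: "fst \<in> \<pi> \<rightarrow>\<^sub>M borel" "snd \<in> \<pi> \<rightarrow>\<^sub>M borel"
      using ps measurable_cong_sets[OF ps refl] by (auto simp: borel_prod[symmetric])
    have "ennreal (g \<epsilon> l u + s * (1 - \<epsilon>)) = (\<integral>\<^sup>+z. ennreal (min (depth l u z) s) \<partial>distr (distr \<pi> borel snd) borel b)"
      using nn_integral_min_depth[of s u l] s I by (simp add: distr_b pP)
    also have "\<dots> = (\<integral>\<^sup>+z. ennreal (min (depth l u (b (snd z))) s) \<partial>\<pi>)"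
      by (simp add: nn_integral_distr)
    also have "\<dots> \<le> (\<integral>\<^sup>+z. ennreal (N (fst z - snd z)) + ennreal s * indicator E (fst z) \<partial>\<pi>)"
    proof (rule nn_integral_mono)
      fix z
      have N0: "0 \<le> N (fst z - snd z)" using b_le_N[of "fst z" "snd z"] by linarith
      show "ennreal (min (depth l u (b (snd z))) s) \<le> ennreal (N (fst z - snd z)) + ennreal s * indicator E (fst z)"
      proof (cases "fst z \<in> E")
        case True
        have "ennreal (min (depth l u (b (snd z))) s) \<le> ennreal s" by (intro ennreal_leI) simp
        also have "\<dots> \<le> ennreal (N (fst z - snd z)) + ennreal s" by simp
        finally show ?thesis using True by simp
      next
        case False
        then have "depth l u (b (snd z)) \<le> N (fst z - snd z)"
          using depth_le_dist[of "b (fst z)" l u "b (snd z)"] b_le_N[of "fst z" "snd z"] by (auto simp: E_def)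
        then show ?thesis using False by (auto intro!: ennreal_leI)
      qed
    qed
    also have "\<dots> = (\<integral>\<^sup>+z. ennreal (N (fst z - snd z)) \<partial>\<pi>) + ennreal s * (\<integral>\<^sup>+z. indicator E (fst z) \<partial>\<pi>)"
      by (subst nn_integral_add) (auto simp: nn_integral_cmult)
    also have "(\<integral>\<^sup>+z. indicator E (fst z) \<partial>\<pi>) = (\<integral>\<^sup>+y. indicator E y \<partial>distr \<pi> borel fst)"
      by (subst nn_integral_distr) auto
    also have "\<dots> = ennreal p"
      by (simp add: pQ Qs Q.emeasure_eq_measure p_def)
    finally have "ennreal (g \<epsilon> l u + s * (1 - \<epsilon>)) \<le> (\<integral>\<^sup>+z. ennreal (N (fst z - snd z)) \<partial>\<pi>) + ennreal (s * p)"
      using s by (simp add: ennreal_mult')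
    then show ?thesis using s by (intro ennreal_diff_le) (auto simp: p_def)
  qed
  have "ennreal (g \<epsilon> l u + s * (1 - \<epsilon>) - s * p) \<le> ennreal \<delta>"
    using W low unfolding wasserstein_def by (meson INF_greatest order_trans)
  then have "g \<epsilon> l u + s * (1 - \<epsilon>) - s * p \<le> \<delta>"
    using assms(3) by (simp add: ennreal_le_iff)
  moreover have "s * (1 - \<epsilon>) - s * p > 0" using s p by simp
  ultimately show False using assms(4) by simp
qed

text \<open>A transport \<open>\<tau>\<close> on the line is lifted along \<open>v\<close>; the graph of the lifted map is a coupling with the same cost.\<close>

lemma shifted_in_ball:
  assumes [measurable]: "\<tau> \<in> borel_measurable borel"
    and cost: "(\<integral>\<^sup>+z. ennreal \<bar>\<tau> z\<bar> \<partial>std_normal_distribution) \<le> ennreal \<delta>"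
  obtains Q where "Q \<in> wasserstein_ball N \<delta> P"
    and "measure Q {y. l \<le> b y \<and> b y \<le> u} = measure std_normal_distribution {z. l \<le> z + \<tau> z \<and> z + \<tau> z \<le> u}"
proof
  define T where "T y = y + \<tau> (b y) *\<^sub>R v" for y
  have [measurable]: "T \<in> borel_measurable borel" unfolding T_def by measurable
  note [measurable_cong] = sets_P
  define \<pi> where "\<pi> = distr P borel (\<lambda>y. (T y, y))"
  have [measurable]: "(\<lambda>y. (T y, y)) \<in> P \<rightarrow>\<^sub>M borel" by (simp flip: borel_prod)
  have [measurable]: "fst \<in> (borel :: ('a \<times> 'a) measure) \<rightarrow>\<^sub>M borel" "snd \<in> (borel :: ('a \<times> 'a) measure) \<rightarrow>\<^sub>M borel"
    by (simp_all flip: borel_prod)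
  have "\<pi> \<in> couplings (distr P borel T) P"
    unfolding couplings_def \<pi>_def
    by (auto intro!: prob_space_distr simp: distr_distr o_def distr_id2 sets_P)
  then have "wasserstein N (distr P borel T) P \<le> (\<integral>\<^sup>+z. ennreal (N (fst z - snd z)) \<partial>\<pi>)"
    unfolding wasserstein_def by (rule INF_lower)
  also have "\<dots> = (\<integral>\<^sup>+y. ennreal (N (T y - y)) \<partial>P)"
    unfolding \<pi>_def by (subst nn_integral_distr) (auto simp flip: borel_prod)
  also have "\<dots> = (\<integral>\<^sup>+y. ennreal \<bar>\<tau> (b y)\<bar> \<partial>P)"
    by (simp add: T_def N_shift)
  also have "\<dots> = (\<integral>\<^sup>+z. ennreal \<bar>\<tau> z\<bar> \<partial>distr P borel b)"
    by (simp add: nn_integral_distr)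
  also have "\<dots> \<le> ennreal \<delta>" using cost by (simp add: distr_b)
  finally show "distr P borel T \<in> wasserstein_ball N \<delta> P"
    by (simp add: wasserstein_ball_def prob_space_distr)
  have "measure (distr P borel T) {y. l \<le> b y \<and> b y \<le> u} = measure P {y. l \<le> b (T y) \<and> b (T y) \<le> u}"
    using sets_eq_imp_space_eq[OF sets_P] by (subst measure_distr) (auto simp: vimage_def)
  also have "\<dots> = measure P {y. l \<le> b y + \<tau> (b y) \<and> b y + \<tau> (b y) \<le> u}"
    by (simp add: T_def b_shift)
  also have "\<dots> = measure (distr P borel b) {z. l \<le> z + \<tau> z \<and> z + \<tau> z \<le> u}"
    using sets_eq_imp_space_eq[OF sets_P] by (subst measure_distr) (auto simp: vimage_def)
  finally show "measure (distr P borel T) {y. l \<le> b y \<and> b y \<le> u}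
    = measure std_normal_distribution {z. l \<le> z + \<tau> z \<and> z + \<tau> z \<le> u}"
    by (simp add: distr_b)
qed

text \<open>The adversary pushes the mass of depth at most \<open>s\<close>, the cheapest one, slightly beyond the nearer endpoint. If the reference distribution
  does not violate the constraint already, choosing \<open>s\<close> with core mass slightly below \<open>1 - \<epsilon>\<close> violates the constraint, and the cost is close to
  \<open>integral {0..s} (core_mass l u) - s * (1 - \<epsilon>) \<le> g \<epsilon> l u\<close>.\<close>

lemma violating_distribution:
  assumes \<epsilon>: "0 < \<epsilon>" "\<epsilon> < 1" and \<delta>: "0 < \<delta>" "g \<epsilon> l u < \<delta>"
  obtains Q where "Q \<in> wasserstein_ball N \<delta> P" "measure Q {y. l \<le> b y \<and> b y \<le> u} < 1 - \<epsilon>"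
proof (cases "1 - \<epsilon> \<le> core_mass l u 0")
  case False
  obtain Q where Q: "Q \<in> wasserstein_ball N \<delta> P"
    "measure Q {y. l \<le> b y \<and> b y \<le> u} = measure std_normal_distribution {z. l \<le> z + 0 \<and> z + 0 \<le> u}"
    by (rule shifted_in_ball[of "\<lambda>_. 0" \<delta> l u]) auto
  have "measure std_normal_distribution {l..u} < 1 - \<epsilon>"
    using False \<epsilon> by (cases "l \<le> u") (auto simp: measure_std_normal_atLeastAtMost core_mass_def)
  with Q that show ?thesis by (simp add: atLeastAtMost_def atLeast_def atMost_def Int_def)
next
  case True
  then have lu: "l < u" using core_mass_nonpos[of u l 0] \<epsilon> by force
  \<comment> \<open>For \<open>2 * s \<le> u - l\<close>, lowering the core mass by \<open>\<kappa>\<close> costs at most \<open>s * \<kappa> \<le> (\<delta> - g \<epsilon> l u) / 2\<close>; overshooting by \<open>\<eta>\<close> uses the other half of the slack.\<close>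
  define \<kappa> where "\<kappa> = min (1 - \<epsilon>) ((\<delta> - g \<epsilon> l u) / (u - l))"
  define \<eta> where "\<eta> = (\<delta> - g \<epsilon> l u) / 2"
  have \<kappa>: "0 < \<kappa>" "\<kappa> \<le> 1 - \<epsilon>" "(u - l) * \<kappa> \<le> \<delta> - g \<epsilon> l u"
    using \<epsilon> \<delta> lu by (auto simp: \<kappa>_def min_le_iff_disj field_simps)
       (simp add: min_def field_simps)
  have \<eta>: "\<eta> > 0" using \<delta> by (simp add: \<eta>_def)
  obtain s where s: "0 \<le> s" "2 * s \<le> u - l" "core_mass l u s = 1 - \<epsilon> - \<kappa>"
    using core_mass_crossing[of "1 - \<epsilon> - \<kappa>" l u] True \<kappa> lu by auto
  have s\<kappa>: "s * \<kappa> \<le> \<eta>"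
  proof -
    have "2 * s * \<kappa> \<le> (u - l) * \<kappa>" using s \<kappa> by (intro mult_right_mono) auto
    also note \<kappa>(3)
    finally show ?thesis by (simp add: \<eta>_def)
  qed
  define \<tau> where "\<tau> z = (if l \<le> z \<and> z \<le> u \<and> depth l u z \<le> s then (if z - l \<le> u - z then l - \<eta> - z else u + \<eta> - z) else 0)" for z
  have [measurable]: "\<tau> \<in> borel_measurable borel" unfolding \<tau>_def by measurable
  have stay: "{z. l \<le> z + \<tau> z \<and> z + \<tau> z \<le> u} = {z. s < depth l u z}"
    using \<eta> s(1) by (auto simp: \<tau>_def depth_def split: if_splits)
  define c where "c = core_mass l u s"
  have c: "0 \<le> c" "c = 1 - \<epsilon> - \<kappa>" using s \<kappa> by (auto simp: c_def)
  have core_ge: "0 \<le> core_mass l u t" if "t \<le> s" for t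
    using core_mass_antimono[OF that, of l u] c(1) by (simp add: c_def)
  have I: "integral {0..s} (core_mass l u) \<le> g \<epsilon> l u + s * (1 - \<epsilon>)"
    using g_ge_integral[OF \<epsilon>(2) s(1), of l u] s(1) by (simp add: integral_core_mass_diff)
  have "(\<integral>\<^sup>+z. ennreal \<bar>\<tau> z\<bar> \<partial>std_normal_distribution) + ennreal (s * c)
      = (\<integral>\<^sup>+z. ennreal \<bar>\<tau> z\<bar> + ennreal s * indicator {z. s < depth l u z} z \<partial>std_normal_distribution)"
    using s(1) c(1) measure_less_depth[OF s(1,2)]
    by (subst nn_integral_add) (auto simp: nn_integral_cmult std_normal.emeasure_eq_measure ennreal_mult' c_def)
  also have "\<dots> \<le> (\<integral>\<^sup>+z. ennreal (min (depth l u z) s) + ennreal \<eta> \<partial>std_normal_distribution)"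
  proof (rule nn_integral_mono)
    fix z
    have "\<bar>\<tau> z\<bar> + s * indicator {z. s < depth l u z} z \<le> min (depth l u z) s + \<eta>"
      using \<eta> s(1) by (auto simp: \<tau>_def indicator_def depth_def)
    then show "ennreal \<bar>\<tau> z\<bar> + ennreal s * indicator {z. s < depth l u z} z \<le> ennreal (min (depth l u z) s) + ennreal \<eta>"
      using s(1) \<eta> by (auto simp: indicator_def depth_def simp flip: ennreal_plus intro!: ennreal_leI)
  qed
  also have "\<dots> = ennreal (integral {0..s} (core_mass l u)) + ennreal \<eta>"
    using nn_integral_min_depth[OF s(1,2)]
    by (subst nn_integral_add) (auto simp: std_normal.emeasure_space_1[simplified])
  also have "\<dots> = ennreal (integral {0..s} (core_mass l u) + \<eta>)"
    using \<eta> s by (intro ennreal_plus[symmetric] integral_nonneg)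
      (use core_mass_integrable[of l u 0] core_ge in auto)
  finally have "(\<integral>\<^sup>+z. ennreal \<bar>\<tau> z\<bar> \<partial>std_normal_distribution) \<le> ennreal (integral {0..s} (core_mass l u) + \<eta> - s * c)"
    using s(1) c(1) by (intro ennreal_le_diff) auto
  also have "\<dots> \<le> ennreal \<delta>"
  proof (rule ennreal_leI)
    have "s * (1 - \<epsilon>) - s * c = s * \<kappa>" by (simp add: c(2) algebra_simps)
    then show "integral {0..s} (core_mass l u) + \<eta> - s * c \<le> \<delta>"
      using I s\<kappa> by (simp add: \<eta>_def field_simps)
  qed
  finally have "(\<integral>\<^sup>+z. ennreal \<bar>\<tau> z\<bar> \<partial>std_normal_distribution) \<le> ennreal \<delta>" .
  from shifted_in_ball[OF \<open>\<tau> \<in> borel_measurable borel\<close> this, of l u]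
  obtain Q where Q: "Q \<in> wasserstein_ball N \<delta> P"
    "measure Q {y. l \<le> b y \<and> b y \<le> u} = measure std_normal_distribution {z. s < depth l u z}"
    unfolding stay by blast
  show ?thesis
    using Q(2) measure_less_depth[OF s(1,2)] s(3) \<kappa> by (intro that[OF Q(1)]) simp
qed

lemma robust_chance_constraint_iff:
  assumes "0 < \<epsilon>" "\<epsilon> < 1" "0 < \<delta>"
  shows "(INF Q\<in>wasserstein_ball N \<delta> P. measure Q {y. l \<le> b y \<and> b y \<le> u}) \<ge> 1 - \<epsilon> \<longleftrightarrow> \<delta> \<le> g \<epsilon> l u"
proof
  assume ge: "(INF Q\<in>wasserstein_ball N \<delta> P. measure Q {y. l \<le> b y \<and> b y \<le> u}) \<ge> 1 - \<epsilon>"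
  show "\<delta> \<le> g \<epsilon> l u"
  proof (rule ccontr)
    assume "\<not> \<delta> \<le> g \<epsilon> l u"
    then obtain Q where Q: "Q \<in> wasserstein_ball N \<delta> P" "measure Q {y. l \<le> b y \<and> b y \<le> u} < 1 - \<epsilon>"
      using violating_distribution[of \<epsilon> \<delta> l u] assms by auto
    have "(INF Q\<in>wasserstein_ball N \<delta> P. measure Q {y. l \<le> b y \<and> b y \<le> u}) \<le> measure Q {y. l \<le> b y \<and> b y \<le> u}"
      by (rule cINF_lower[OF _ Q(1)]) (auto intro: bdd_belowI2[of _ 0])
    then show False using ge Q(2) by simp
  qed
next
  assume "\<delta> \<le> g \<epsilon> l u"
  moreover have "wasserstein_ball N \<delta> P \<noteq> {}"
    using shifted_in_ball[of "\<lambda>_. 0" \<delta>] by fastforce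
  ultimately show "(INF Q\<in>wasserstein_ball N \<delta> P. measure Q {y. l \<le> b y \<and> b y \<le> u}) \<ge> 1 - \<epsilon>"
    using assms by (intro cINF_greatest measure_ge_if_g_ge)
qed

end

section \<open>Shape of the superlevel sets of g\<close>

lemma g_mono:
  assumes "\<epsilon> < 1" "l' \<le> l" "u \<le> u'"
  shows "g \<epsilon> l u \<le> g \<epsilon> l' u'"
proof -
  define S where "S = max 0 (u' - l')"
  have "g \<epsilon> l u = integral {0..S} (\<lambda>t. max (core_mass l u t - (1 - \<epsilon>)) 0)"
    by (rule g_eq_integral[OF assms(1)]) (use assms in \<open>auto simp: S_def max_def\<close>)
  also have "\<dots> \<le> integral {0..S} (\<lambda>t. max (core_mass l' u' t - (1 - \<epsilon>)) 0)"
    using core_mass_mono[OF assms(2,3)] by (intro integral_le excess_integrable max.mono diff_right_mono) auto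
  also have "\<dots> = g \<epsilon> l' u'"
    by (rule g_eq_integral[OF assms(1), symmetric]) (auto simp: S_def max_def)
  finally show ?thesis .
qed

text \<open>Near a given point one bounded range of integration serves all \<open>l\<close> and \<open>u\<close>, so \<open>g\<close> is locally an integral over a fixed
  compact interval with continuous dependence on parameters.\<close>

lemma continuous_on_g:
  assumes "\<epsilon> < 1"
  shows "continuous_on UNIV (\<lambda>p. g \<epsilon> (fst p) (snd p))"
proof (rule continuous_at_imp_continuous_on, intro ballI)
  fix p :: "real \<times> real"
  define S where "S = max 0 (snd p - fst p + 1)"
  \<comment> \<open>The margin 1 in \<open>S\<close> makes the range valid in a whole neighbourhood of \<open>p\<close>.\<close>
  define h where "h q = integral {0..S} (\<lambda>t. max (core_mass (fst q) (snd q) t - (1 - \<epsilon>)) 0)" for q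
  have Phi: "continuous_on A (\<lambda>x. Phi (k x))" if "continuous_on A k" for A and k :: "(real \<times> real) \<times> real \<Rightarrow> real"
    using continuous_on_compose2[OF continuous_on_Phi that] by blast
  have "continuous_on UNIV (\<lambda>q. integral (cbox 0 S) (\<lambda>t. max (core_mass (fst q) (snd q) t - (1 - \<epsilon>)) 0))"
    unfolding core_mass_def
    by (rule integral_continuous_on_param)
      (auto simp: case_prod_unfold intro!: continuous_intros Phi)
  then have "isCont h p" by (cases p) (simp add: h_def[abs_def] continuous_on_eq_continuous_at)
  moreover have "eventually (\<lambda>q. h q = g \<epsilon> (fst q) (snd q)) (nhds p)"
    unfolding eventually_nhds
  proof (intro exI conjI ballI)
    show "open {q. snd q - fst q < snd p - fst p + (1::real)}"
      by (intro open_Collect_less continuous_intros)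
    show "p \<in> {q. snd q - fst q < snd p - fst p + 1}" by simp
    fix q assume "q \<in> {q. snd q - fst q < snd p - fst p + 1}"
    then show "h q = g \<epsilon> (fst q) (snd q)"
      unfolding h_def by (intro g_eq_integral[OF assms, symmetric]) (auto simp: S_def max_def)
  qed
  ultimately show "isCont (\<lambda>p. g \<epsilon> (fst p) (snd p)) p"
    using isCont_cong[of h "\<lambda>p. g \<epsilon> (fst p) (snd p)" p] by simp
qed

text \<open>Since \<open>Phi 0 = 1 / 2\<close>, a core mass above one half puts the shrunk interval around the origin.\<close>

lemma core_mass_gt_half:
  assumes "1 / 2 < core_mass l u t"
  shows "l + t \<le> 0" "0 \<le> u - t"
proof -
  have "0 \<le> Phi (l + t)" "Phi (u - t) \<le> 1"
    by (auto intro: std_normal.cdf_nonneg std_normal.cdf_bounded_prob)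
  moreover have "1 / 2 \<le> Phi (l + t)" if "0 < l + t"
    using Phi_mono[of 0 "l + t"] that by (simp add: Phi_0)
  moreover have "Phi (u - t) \<le> 1 / 2" if "u - t < 0"
    using Phi_mono[of "u - t" 0] that by (simp add: Phi_0)
  ultimately show "l + t \<le> 0" "0 \<le> u - t"
    using assms unfolding core_mass_def by fastforce+
qed

lemma core_mass_concave:
  assumes "1 / 2 < core_mass l0 u0 t0" "1 / 2 < core_mass l1 u1 t1" and "0 \<le> a" "0 \<le> b" "a + b = 1"
  shows "a * core_mass l0 u0 t0 + b * core_mass l1 u1 t1 \<le> core_mass (a * l0 + b * l1) (a * u0 + b * u1) (a * t0 + b * t1)"
proof -
  note h = core_mass_gt_half[OF assms(1)] core_mass_gt_half[OF assms(2)]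
  have "a * Phi (u0 - t0) + b * Phi (u1 - t1) \<le> Phi (a * (u0 - t0) + b * (u1 - t1))"
    using convex_onD[OF Phi_concave, of b "u0 - t0" "u1 - t1"] h assms(3-5) by (simp add: eq_diff_eq[symmetric])
  moreover have "Phi (a * (l0 + t0) + b * (l1 + t1)) \<le> a * Phi (l0 + t0) + b * Phi (l1 + t1)"
    using convex_onD[OF Phi_convex, of b "l0 + t0" "l1 + t1"] h assms(3-5) by (simp add: eq_diff_eq[symmetric])
  ultimately show ?thesis by (simp add: core_mass_def algebra_simps)
qed

lemma has_integral_unit_interval_rescale:
  assumes "0 < (s::real)" "f integrable_on {0..s}"
  shows "((\<lambda>x. f (s * x)) has_integral integral {0..s} f / s) {0..1}"
  using has_integral_affinity'[of f "integral {0..s} f" 0 s s 0] assms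
  by (simp add: integrable_integral field_simps)

lemma weighted_am_hm:
  fixes a b s t :: real
  assumes "0 \<le> a" "0 \<le> b" "a + b = 1" "0 < s" "0 < t"
  shows "1 \<le> (a * s + b * t) * (a / s + b / t)"
proof -
  have "2 \<le> s / t + t / s"
  proof -
    have "0 \<le> (s - t)\<^sup>2 / (s * t)" using assms by simp
    also have "\<dots> = s / t + t / s - 2" using assms by (simp add: power2_diff field_simps power2_eq_square)
    finally show ?thesis by simp
  qed
  then have "a * b * 2 \<le> a * b * (s / t + t / s)" using assms by (intro mult_left_mono) auto
  moreover have "a\<^sup>2 + b\<^sup>2 + a * b * 2 = 1" using power2_sum[of a b] assms(3) by simp
  moreover have "(a * s + b * t) * (a / s + b / t) = a\<^sup>2 + b\<^sup>2 + a * b * (s / t + t / s)"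
    using assms by (simp add: field_simps power2_eq_square)
  ultimately show ?thesis by linarith
qed

text \<open>The function \<open>g\<close> is not concave, but its superlevel sets at positive levels are convex. At the two given points write \<open>g\<close> as the integral of the
  excess up to the crossing points \<open>s0\<close> and \<open>s1\<close> and rescale both ranges to \<open>{0..1}\<close>, so that the integrals become
  \<open>g \<epsilon> l0 u0 / s0\<close> and \<open>g \<epsilon> l1 u1 / s1\<close>. Concavity of the core mass compares their weighted sum with the rescaled integral at
  the intermediate point, where the range has length \<open>a * s0 + b * s1\<close>. Undoing the scaling produces the factor
  \<open>(a * s0 + b * s1) * (a / s0 + b / s1)\<close>, which is at least 1.\<close>

lemma convex_g_superlevel:
  assumes \<delta>: "0 < \<delta>" and \<epsilon>: "0 < \<epsilon>" "\<epsilon> < 1 / 2"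
  shows "convex {(l, u). \<delta> \<le> g \<epsilon> l u}"
proof (rule convexI)
  fix p q :: "real \<times> real" and a b :: real
  assume pq: "p \<in> {(l, u). \<delta> \<le> g \<epsilon> l u}" "q \<in> {(l, u). \<delta> \<le> g \<epsilon> l u}"
    and ab: "0 \<le> a" "0 \<le> b" "a + b = 1"
  obtain l0 u0 l1 u1 where pq_eq: "p = (l0, u0)" "q = (l1, u1)" by (cases p, cases q)
  have g0: "\<delta> \<le> g \<epsilon> l0 u0" and g1: "\<delta> \<le> g \<epsilon> l1 u1" using pq by (simp_all add: pq_eq)
  define c where "c = 1 - \<epsilon>"
  have c: "1 / 2 < c" using \<epsilon> by (simp add: c_def)
  obtain s0 where s0: "0 < s0" "core_mass l0 u0 s0 = c"
    using g_pos_crossing[of \<epsilon> l0 u0] g0 \<delta> \<epsilon> by (auto simp: c_def)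
  obtain s1 where s1: "0 < s1" "core_mass l1 u1 s1 = c"
    using g_pos_crossing[of \<epsilon> l1 u1] g1 \<delta> \<epsilon> by (auto simp: c_def)
  define l u s where "l = a * l0 + b * l1" and "u = a * u0 + b * u1" and "s = a * s0 + b * s1"
  have s: "0 < s"
    using ab s0(1) s1(1) by (cases "a = 0") (auto simp: s_def add_pos_nonneg)
  have G0: "integral {0..s0} (\<lambda>t. core_mass l0 u0 t - c) = g \<epsilon> l0 u0"
    using g_eq_integral_crossing[of \<epsilon> s0 l0 u0] s0 \<epsilon> by (simp add: c_def)
  have G1: "integral {0..s1} (\<lambda>t. core_mass l1 u1 t - c) = g \<epsilon> l1 u1"
    using g_eq_integral_crossing[of \<epsilon> s1 l1 u1] s1 \<epsilon> by (simp add: c_def)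
  have I0: "((\<lambda>x. core_mass l0 u0 (s0 * x) - c) has_integral g \<epsilon> l0 u0 / s0) {0..1}"
    using has_integral_unit_interval_rescale[OF s0(1) core_mass_integrable[of l0 u0 c]] by (simp add: G0)
  have I1: "((\<lambda>x. core_mass l1 u1 (s1 * x) - c) has_integral g \<epsilon> l1 u1 / s1) {0..1}"
    using has_integral_unit_interval_rescale[OF s1(1) core_mass_integrable[of l1 u1 c]] by (simp add: G1)
  have I: "((\<lambda>x. core_mass l u (s * x) - c) has_integral integral {0..s} (\<lambda>t. core_mass l u t - c) / s) {0..1}"
    by (rule has_integral_unit_interval_rescale[OF s core_mass_integrable])
  have "a * (g \<epsilon> l0 u0 / s0) + b * (g \<epsilon> l1 u1 / s1) \<le> integral {0..s} (\<lambda>t. core_mass l u t - c) / s"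
  proof (rule has_integral_le[OF _ I])
    show "((\<lambda>x. a * (core_mass l0 u0 (s0 * x) - c) + b * (core_mass l1 u1 (s1 * x) - c)) has_integral
        a * (g \<epsilon> l0 u0 / s0) + b * (g \<epsilon> l1 u1 / s1)) {0..1}"
      by (intro has_integral_add has_integral_mult_right I0 I1)
    fix x :: real assume x: "x \<in> {0..1}"
    have "s0 * x \<le> s0" "s1 * x \<le> s1" using x s0(1) s1(1) by (auto intro: mult_left_le)
    then have "1 / 2 < core_mass l0 u0 (s0 * x)" "1 / 2 < core_mass l1 u1 (s1 * x)"
      using core_mass_antimono[of "s0 * x" s0 l0 u0] core_mass_antimono[of "s1 * x" s1 l1 u1] s0(2) s1(2) c by auto
    from core_mass_concave[OF this ab]
    have "a * core_mass l0 u0 (s0 * x) + b * core_mass l1 u1 (s1 * x) \<le> core_mass l u (s * x)"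
      by (simp add: l_def u_def s_def algebra_simps)
    moreover have "a * c + b * c = c" using ab by (simp flip: distrib_right)
    ultimately show "a * (core_mass l0 u0 (s0 * x) - c) + b * (core_mass l1 u1 (s1 * x) - c) \<le> core_mass l u (s * x) - c"
      by (simp add: algebra_simps)
  qed
  moreover have "a * (\<delta> / s0) + b * (\<delta> / s1) \<le> a * (g \<epsilon> l0 u0 / s0) + b * (g \<epsilon> l1 u1 / s1)"
    using ab s0(1) s1(1) g0 g1 by (intro add_mono mult_left_mono divide_right_mono) auto
  ultimately have "a * (\<delta> / s0) + b * (\<delta> / s1) \<le> integral {0..s} (\<lambda>t. core_mass l u t - c) / s"
    by (rule order_trans[rotated])
  then have "s * (a * (\<delta> / s0) + b * (\<delta> / s1)) \<le> integral {0..s} (\<lambda>t. core_mass l u t - c)"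
    using s by (simp only: pos_le_divide_eq mult.commute)
  also have "\<dots> \<le> g \<epsilon> l u" using g_ge_integral[of \<epsilon> s l u] s \<epsilon> by (simp add: c_def)
  finally have "\<delta> * (s * (a / s0 + b / s1)) \<le> g \<epsilon> l u" by (simp add: algebra_simps)
  moreover have "\<delta> * 1 \<le> \<delta> * (s * (a / s0 + b / s1))"
    using weighted_am_hm[OF ab s0(1) s1(1)] \<delta> by (intro mult_left_mono) (auto simp: s_def)
  ultimately show "a *\<^sub>R p + b *\<^sub>R q \<in> {(l, u). \<delta> \<le> g \<epsilon> l u}"
    by (simp add: pq_eq l_def u_def)
qed

lemma closed_g_superlevel:
  assumes "\<epsilon> < 1" shows "closed {(l, u). \<delta> \<le> g \<epsilon> l u}"
  unfolding case_prod_unfold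
  by (intro closed_Collect_le continuous_on_g assms continuous_intros)

lemma g_ge_signs:
  assumes "0 < \<delta>" "0 < \<epsilon>" "\<epsilon> < 1 / 2" "\<delta> \<le> g \<epsilon> l u"
  shows "l \<le> 0" "0 \<le> u"
proof -
  obtain s where s: "0 < s" "core_mass l u s = 1 - \<epsilon>"
    using g_pos_crossing[of \<epsilon> l u] assms by auto
  with core_mass_gt_half[of l u s] assms show "l \<le> 0" "0 \<le> u" by auto
qed

text \<open>Makes \<open>Z0_set\<close> nonempty for every \<open>\<delta>\<close>, which is what fills the slice \<open>s = 0\<close> of the closed cone below.\<close>

lemma g_unbounded:
  assumes "0 < \<delta>" "0 < \<epsilon>" "\<epsilon> < 1"
  shows "\<exists>k. \<delta> \<le> g \<epsilon> (-k) k"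
proof -
  have "eventually (\<lambda>x. Phi x > 1 - \<epsilon> / 4) at_top"
    using std_normal.cdf_lim_at_top_prob assms by (intro order_tendstoD) auto
  moreover have "eventually (\<lambda>x. Phi x < \<epsilon> / 4) at_bot"
    using std_normal.cdf_lim_at_bot assms by (intro order_tendstoD) auto
  then have "eventually (\<lambda>x. Phi (- x) < \<epsilon> / 4) at_top"
    by (simp add: at_bot_mirror eventually_filtermap)
  moreover note eventually_ge_at_top[of "0::real"]
  ultimately have "eventually (\<lambda>x. Phi x > 1 - \<epsilon> / 4 \<and> Phi (- x) < \<epsilon> / 4 \<and> 0 \<le> x) at_top"
    by eventually_elim auto
  then obtain r where r: "Phi r > 1 - \<epsilon> / 4" "Phi (- r) < \<epsilon> / 4" "0 \<le> r"
    by (metis (mono_tags, lifting) eventually_at_top_linorder order_refl)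
  define S where "S = 2 * \<delta> / \<epsilon>"
  have S: "0 \<le> S" using assms by (simp add: S_def)
  \<comment> \<open>With \<open>k = r + S\<close> the excess is at least \<open>\<epsilon> / 2\<close> on a range of length \<open>S = 2 * \<delta> / \<epsilon>\<close>.\<close>
  have "\<delta> = integral {0..S} (\<lambda>t. \<epsilon> / 2)" using S assms by (simp add: S_def)
  also have "\<dots> \<le> integral {0..S} (\<lambda>t. core_mass (-(r + S)) (r + S) t - (1 - \<epsilon>))"
  proof (intro integral_le core_mass_integrable)
    fix t assume "t \<in> {0..S}"
    then have "Phi r \<le> Phi (r + S - t)" "Phi (-(r + S) + t) \<le> Phi (- r)"
      by (auto intro!: Phi_mono)
    then show "\<epsilon> / 2 \<le> core_mass (-(r + S)) (r + S) t - (1 - \<epsilon>)"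
      using r by (simp add: core_mass_def)
  qed auto
  also have "\<dots> \<le> g \<epsilon> (-(r + S)) (r + S)" by (rule g_ge_integral[OF assms(3) S])
  finally show ?thesis by blast
qed

section \<open>The feasible sets\<close>

lemma Z0_set_eq:
  assumes "0 < \<delta>" "0 < \<epsilon>" "\<epsilon> < 1"
  shows "Z0_set \<delta> \<epsilon> = {(l, u). \<delta> \<le> g \<epsilon> l u}"
proof -
  interpret normal_projection std_normal_distribution abs "\<lambda>x. x" "1::real"
    by unfold_locales (auto simp: distr_id2)
  show ?thesis
    using robust_chance_constraint_iff[OF assms(2,3,1)] by (auto simp: Z0_set_def)
qed

lemma borel_measurable_primal_norm [measurable]: "primal_norm V \<in> borel_measurable borel"
  unfolding primal_norm_def[abs_def] by measurable

lemma dual_norm_pos: "sym_pos_def V \<Longrightarrow> x \<noteq> 0 \<Longrightarrow> 0 < dual_norm V x"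
  unfolding dual_norm_def zero_less_norm_iff
  using sym_pos_def_mult_eq_0_iff[OF sym_pos_def_matrix_sqrt] by blast

lemma dual_norm_0 [simp]: "dual_norm V 0 = 0"
  by (simp add: dual_norm_def)

lemma dual_norm_nonneg: "0 \<le> dual_norm V x"
  by (simp add: dual_norm_def)

lemma dual_norm_convex:
  assumes "0 \<le> a" "0 \<le> b"
  shows "dual_norm V (a *\<^sub>R x + b *\<^sub>R y) \<le> a * dual_norm V x + b * dual_norm V y"
  using norm_triangle_ineq[of "a *\<^sub>R (matrix_sqrt V *v x)" "b *\<^sub>R (matrix_sqrt V *v y)"] assms
  by (simp add: dual_norm_def matrix_vector_right_distrib matrix_vector_mult_scaleR)

lemma continuous_dual_norm: "continuous_on A (dual_norm V)"
  unfolding dual_norm_def[abs_def]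
  by (intro continuous_on_norm linear_continuous_on matrix_vector_mul_bounded_linear)

text \<open>With \<open>B\<close> the square root of \<open>V\<close>, the bound on \<open>b\<close> is the Cauchy-Schwarz inequality for \<open>B x\<close> and \<open>matrix_inv B *v (y - y')\<close>;
  the direction \<open>v\<close> is the one for which it is an equality.\<close>

lemma normal_projection_gaussian:
  fixes x m :: "real^'n"
  assumes V: "sym_pos_def V" and x: "x \<noteq> 0"
  shows "normal_projection (gaussian m V) (primal_norm V) (\<lambda>y. (x \<bullet> y - x \<bullet> m) / dual_norm V x)
    ((1 / dual_norm V x) *\<^sub>R (V *v x))"
proof -
  define B where "B = matrix_sqrt V"
  define s where "s = dual_norm V x"
  have s: "s > 0" "s = norm (B *v x)" using dual_norm_pos[OF V x] by (auto simp: s_def dual_norm_def B_def)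
  have B: "sym_pos_def B" "B ** B = V"
    unfolding B_def by (rule matrix_sqrt[OF V])+
  have Binv: "B *v (matrix_inv B *v z) = z" "matrix_inv B *v (B *v z) = z" for z
    using matrix_inv[OF sym_pos_def_invertible[OF B(1)]] by (simp_all add: matrix_vector_mul_assoc)
  have Vx: "V *v x = B *v (B *v x)" by (simp add: matrix_vector_mul_assoc B(2))
  have xVx: "x \<bullet> (V *v x) = s\<^sup>2"
    by (simp add: Vx sym_pos_def_inner[OF B(1)] s(2) power2_norm_eq_inner)
  have distr: "distr (gaussian m V) borel (\<lambda>y. (x \<bullet> y - x \<bullet> m) / s) = std_normal_distribution"
    unfolding s_def by (rule gaussian_affine_marginal[OF V x])
  have sets: "sets (gaussian m V) = sets borel" by (simp add: gaussian_def)
  note [measurable_cong] = sets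
  have "prob_space (gaussian m V)"
  proof (rule prob_space_distrD)
    show "prob_space (distr (gaussian m V) borel (\<lambda>y. (x \<bullet> y - x \<bullet> m) / s))"
      unfolding distr by (rule std_normal.prob_space_axioms)
  qed measurable
  moreover have "\<bar>(x \<bullet> y - x \<bullet> m) / s - (x \<bullet> y' - x \<bullet> m) / s\<bar> \<le> primal_norm V (y - y')" for y y'
  proof -
    have "\<bar>x \<bullet> (y - y')\<bar> = \<bar>(B *v x) \<bullet> (matrix_inv B *v (y - y'))\<bar>"
      by (simp add: sym_pos_def_inner[OF B(1), symmetric] Binv)
    also have "\<dots> \<le> s * primal_norm V (y - y')"
      unfolding s(2) primal_norm_def B_def by (rule Cauchy_Schwarz_ineq2)
    finally have "\<bar>x \<bullet> (y - y')\<bar> / s \<le> primal_norm V (y - y')"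
      using s(1) by (simp add: pos_divide_le_eq mult.commute)
    then show ?thesis using s(1) by (simp add: inner_diff_right abs_divide flip: diff_divide_distrib)
  qed
  moreover have "(x \<bullet> (y + r *\<^sub>R ((1 / s) *\<^sub>R (V *v x))) - x \<bullet> m) / s = (x \<bullet> y - x \<bullet> m) / s + r" for y r
    using s(1) by (simp add: inner_add_right xVx field_simps power2_eq_square)
  moreover have "primal_norm V (r *\<^sub>R ((1 / s) *\<^sub>R (V *v x))) = \<bar>r\<bar>" for r
    using s by (simp add: primal_norm_def B_def[symmetric] matrix_vector_mult_scaleR Vx Binv)
  ultimately show ?thesis
    using sets distr unfolding s_def[symmetric] normal_projection_def normal_projection_axioms_def
    by (intro conjI) (simp_all add: s_def)
qed

lemma Z_set_nonzero_iff:
  fixes x m :: "real^'n"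
  assumes \<delta>: "0 < \<delta>" "0 < \<epsilon>" "\<epsilon> < 1" and V: "sym_pos_def V" and x: "x \<noteq> 0"
  shows "(x, l, u) \<in> Z_set m V \<delta> \<epsilon> \<longleftrightarrow>
    ((l - x \<bullet> m) / dual_norm V x, (u - x \<bullet> m) / dual_norm V x) \<in> Z0_set \<delta> \<epsilon>"
proof -
  define s where "s = dual_norm V x"
  have s: "s > 0" using dual_norm_pos[OF V x] by (simp add: s_def)
  interpret normal_projection "gaussian m V" "primal_norm V" "\<lambda>y. (x \<bullet> y - x \<bullet> m) / s" "(1 / s) *\<^sub>R (V *v x)"
    unfolding s_def by (rule normal_projection_gaussian[OF V x])
  have "{\<xi>. l \<le> x \<bullet> \<xi> \<and> x \<bullet> \<xi> \<le> u}
     = {y. (l - x \<bullet> m) / s \<le> (x \<bullet> y - x \<bullet> m) / s \<and> (x \<bullet> y - x \<bullet> m) / s \<le> (u - x \<bullet> m) / s}"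
    using s by (auto simp: divide_le_cancel)
  then have "(x, l, u) \<in> Z_set m V \<delta> \<epsilon> \<longleftrightarrow> \<delta> \<le> g \<epsilon> ((l - x \<bullet> m) / s) ((u - x \<bullet> m) / s)"
    using robust_chance_constraint_iff[OF \<delta>(2,3,1)] by (simp add: Z_set_def)
  then show ?thesis by (simp add: Z0_set_eq[OF \<delta>] s_def)
qed

text \<open>For \<open>x = 0\<close> there is no randomness left: the event is everything or empty, and the infimum is 1 or 0.\<close>

lemma Z_set_zero_iff:
  fixes m :: "real^'n"
  assumes \<delta>: "0 < \<delta>" "0 < \<epsilon>" "\<epsilon> < 1" and V: "sym_pos_def V"
  shows "(0, l, u) \<in> Z_set m V \<delta> \<epsilon> \<longleftrightarrow> l \<le> 0 \<and> 0 \<le> u"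
proof -
  define x :: "real^'n" where "x = axis undefined 1"
  have x: "x \<noteq> 0" by (simp add: x_def)
  interpret normal_projection "gaussian m V" "primal_norm V" "\<lambda>y. (x \<bullet> y - x \<bullet> m) / dual_norm V x" "(1 / dual_norm V x) *\<^sub>R (V *v x)"
    by (rule normal_projection_gaussian[OF V x])
  have ne: "wasserstein_ball (primal_norm V) \<delta> (gaussian m V) \<noteq> {}"
    using shifted_in_ball[of "\<lambda>_. 0" \<delta>] by fastforce
  have "measure Q UNIV = 1" if "Q \<in> wasserstein_ball (primal_norm V) \<delta> (gaussian m V)" for Q
    using that prob_space.prob_space[of Q] sets_eq_imp_space_eq[of Q borel] by (auto simp: wasserstein_ball_def)
  then have "(INF Q\<in>wasserstein_ball (primal_norm V) \<delta> (gaussian m V). measure Q {\<xi>. l \<le> 0 \<and> 0 \<le> u})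
      = (if l \<le> 0 \<and> 0 \<le> u then 1 else 0)"
    using ne by (auto simp: cong: INF_cong)
  then show ?thesis using \<delta> by (simp add: Z_set_def)
qed

lemma
  assumes \<delta>: "0 < \<delta>" "0 < \<epsilon>" "\<epsilon> < 1 / 2"
  shows convex_Z0_set: "convex (Z0_set \<delta> \<epsilon>)"
    and closed_Z0_set: "closed (Z0_set \<delta> \<epsilon>)"
    and Z0_set_signs: "(l, u) \<in> Z0_set \<delta> \<epsilon> \<Longrightarrow> l \<le> 0 \<and> 0 \<le> u"
    and Z0_set_mono: "(l, u) \<in> Z0_set \<delta> \<epsilon> \<Longrightarrow> l' \<le> l \<Longrightarrow> u \<le> u' \<Longrightarrow> (l', u') \<in> Z0_set \<delta> \<epsilon>"
  using convex_g_superlevel[OF \<delta>] closed_g_superlevel[of \<epsilon> \<delta>] g_ge_signs[OF \<delta>, of l u]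
    g_mono[of \<epsilon> l' l u u'] \<delta>
  by (auto simp: Z0_set_eq)

definition scaled_Z0 :: "real \<Rightarrow> real \<Rightarrow> (real \<times> real \<times> real) set" where
  "scaled_Z0 \<delta> \<epsilon> = {(l, u, s). s > 0 \<and> (l / s, u / s) \<in> Z0_set \<delta> \<epsilon>}"

lemma Z1_set_eq: "Z1_set \<delta> \<epsilon> = closure (scaled_Z0 \<delta> \<epsilon>)"
  by (simp add: Z1_set_def scaled_Z0_def)

lemma closed_Z1_set: "closed (Z1_set \<delta> \<epsilon>)"
  by (simp add: Z1_set_def)

lemma convex_Z1_set:
  assumes "0 < \<delta>" "0 < \<epsilon>" "\<epsilon> < 1 / 2"
  shows "convex (Z1_set \<delta> \<epsilon>)"
  unfolding Z1_set_eq
proof (rule convex_closure, rule convexI)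
  fix p q :: "real \<times> real \<times> real" and a b :: real
  assume pq: "p \<in> scaled_Z0 \<delta> \<epsilon>" "q \<in> scaled_Z0 \<delta> \<epsilon>" and ab: "0 \<le> a" "0 \<le> b" "a + b = 1"
  obtain l0 u0 s0 l1 u1 s1 where eq: "p = (l0, u0, s0)" "q = (l1, u1, s1)" by (cases p, cases q)
  have s: "s0 > 0" "s1 > 0" and Z: "(l0 / s0, u0 / s0) \<in> Z0_set \<delta> \<epsilon>" "(l1 / s1, u1 / s1) \<in> Z0_set \<delta> \<epsilon>"
    using pq by (simp_all add: eq scaled_Z0_def)
  define t where "t = a * s0 + b * s1"
  have t: "t > 0" using ab s by (cases "a = 0") (auto simp: t_def add_pos_nonneg)
  have "(a * s0 / t) *\<^sub>R (l0 / s0, u0 / s0) + (b * s1 / t) *\<^sub>R (l1 / s1, u1 / s1) \<in> Z0_set \<delta> \<epsilon>"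
    using convex_Z0_set[OF assms] Z
    by (rule convexD) (use ab s t in \<open>auto simp: t_def simp flip: add_divide_distrib\<close>)
  then show "a *\<^sub>R p + b *\<^sub>R q \<in> scaled_Z0 \<delta> \<epsilon>"
    using s t by (simp add: eq scaled_Z0_def t_def[symmetric] add_divide_distrib)
qed

lemma Z1_set_signs:
  assumes "0 < \<delta>" "0 < \<epsilon>" "\<epsilon> < 1 / 2" "(l, u, s) \<in> Z1_set \<delta> \<epsilon>"
  shows "l \<le> 0" "0 \<le> u" "0 \<le> s"
proof -
  have "closure (scaled_Z0 \<delta> \<epsilon>) \<subseteq> {p. fst p \<le> 0 \<and> 0 \<le> fst (snd p) \<and> 0 \<le> snd (snd p)}"
  proof (rule closure_minimal)
    show "scaled_Z0 \<delta> \<epsilon> \<subseteq> {p. fst p \<le> 0 \<and> 0 \<le> fst (snd p) \<and> 0 \<le> snd (snd p)}"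
      using Z0_set_signs[OF assms(1-3)]
      by (fastforce simp: scaled_Z0_def divide_le_0_iff zero_le_divide_iff)
    show "closed {p :: real \<times> real \<times> real. fst p \<le> 0 \<and> 0 \<le> fst (snd p) \<and> 0 \<le> snd (snd p)}"
      by (intro closed_Collect_conj closed_Collect_le continuous_intros)
  qed
  then show "l \<le> 0" "0 \<le> u" "0 \<le> s" using assms(4) by (auto simp: Z1_set_eq)
qed

lemma Z1_set_pos_iff:
  assumes "0 < \<delta>" "0 < \<epsilon>" "\<epsilon> < 1 / 2" "0 < s"
  shows "(l, u, s) \<in> Z1_set \<delta> \<epsilon> \<longleftrightarrow> (l / s, u / s) \<in> Z0_set \<delta> \<epsilon>"
proof
  assume "(l / s, u / s) \<in> Z0_set \<delta> \<epsilon>"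
  then have "(l, u, s) \<in> scaled_Z0 \<delta> \<epsilon>" using assms by (simp add: scaled_Z0_def)
  then show "(l, u, s) \<in> Z1_set \<delta> \<epsilon>" using closure_subset Z1_set_eq by blast
next
  assume "(l, u, s) \<in> Z1_set \<delta> \<epsilon>"
  then obtain p where p: "\<And>n. p n \<in> scaled_Z0 \<delta> \<epsilon>" "p \<longlonglongrightarrow> (l, u, s)"
    by (auto simp: Z1_set_eq closure_sequential)
  let ?q = "\<lambda>n. (fst (p n) / snd (snd (p n)), fst (snd (p n)) / snd (snd (p n)))"
  have "?q n \<in> Z0_set \<delta> \<epsilon>" for n
    using p(1)[of n] by (auto simp: scaled_Z0_def)
  moreover have "?q \<longlonglongrightarrow> (l / s, u / s)"
    using tendsto_fst[OF p(2)] tendsto_fst[OF tendsto_snd[OF p(2)]] tendsto_snd[OF tendsto_snd[OF p(2)]] assms(4)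
    by (intro tendsto_Pair tendsto_divide) auto
  ultimately show "(l / s, u / s) \<in> Z0_set \<delta> \<epsilon>"
    by (rule closed_sequentially[OF closed_Z0_set[OF assms(1-3)], of ?q])
qed

text \<open>The points \<open>(l - k r, u + k r, r)\<close> with \<open>(- k, k)\<close> in \<open>Z0_set\<close> lie in the cone and tend to \<open>(l, u, 0)\<close> as \<open>r \<rightarrow> 0\<close>.\<close>

lemma Z1_set_zero:
  assumes "0 < \<delta>" "0 < \<epsilon>" "\<epsilon> < 1 / 2" "l \<le> 0" "0 \<le> u"
  shows "(l, u, 0) \<in> Z1_set \<delta> \<epsilon>"
proof -
  obtain k where k: "(-k, k) \<in> Z0_set \<delta> \<epsilon>"
    using g_unbounded[of \<delta> \<epsilon>] assms by (auto simp: Z0_set_eq)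
  define p where "p n = (l - k * inverse (real (Suc n)), u + k * inverse (real (Suc n)), inverse (real (Suc n)))" for n
  have "p n \<in> Z1_set \<delta> \<epsilon>" for n
  proof -
    define r where "r = inverse (real (Suc n))"
    have r: "r > 0" by (simp add: r_def)
    have "((l - k * r) / r, (u + k * r) / r) \<in> Z0_set \<delta> \<epsilon>"
      by (rule Z0_set_mono[OF assms(1-3) k]) (use r assms in \<open>auto simp: field_simps\<close>)
    then show ?thesis using Z1_set_pos_iff[OF assms(1-3) r] by (simp add: p_def r_def)
  qed
  moreover have "p \<longlonglongrightarrow> (l - k * 0, u + k * 0, 0)"
    unfolding p_def by (intro tendsto_intros LIMSEQ_inverse_real_of_nat)
  ultimately show ?thesis
    using closed_sequentially[OF closed_Z1_set] by fastforce
qed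

text \<open>Because \<open>l \<le> 0 \<le> u\<close>, dividing by a smaller scale widens the interval. Hence the existential quantifier over
  \<open>s \<ge> dual_norm V x\<close> can be resolved by the smallest admissible \<open>s\<close>.\<close>

lemma Z1_set_downward:
  assumes "0 < \<delta>" "0 < \<epsilon>" "\<epsilon> < 1 / 2" and Z1: "(l, u, s) \<in> Z1_set \<delta> \<epsilon>" and r: "0 \<le> r" "r \<le> s"
  shows "(l, u, r) \<in> Z1_set \<delta> \<epsilon>"
proof (cases "r = 0")
  case True
  then show ?thesis using Z1_set_signs[OF assms(1-4)] Z1_set_zero[OF assms(1-3)] by simp
next
  case False
  then have rs: "0 < r" "0 < s" using r by auto
  have "(l / s, u / s) \<in> Z0_set \<delta> \<epsilon>" using Z1 Z1_set_pos_iff[OF assms(1-3) rs(2)] by simp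
  moreover have "l / r \<le> l / s" "u / s \<le> u / r"
    using Z1_set_signs[OF assms(1-4)] rs r by (auto intro: divide_left_mono divide_left_mono_neg)
  ultimately have "(l / r, u / r) \<in> Z0_set \<delta> \<epsilon>" by (rule Z0_set_mono[OF assms(1-3)])
  then show ?thesis using Z1_set_pos_iff[OF assms(1-3) rs(1)] by simp
qed

lemma Z_set_iff_Z1:
  fixes x m :: "real^'n"
  assumes "0 < \<delta>" "0 < \<epsilon>" "\<epsilon> < 1 / 2" and V: "sym_pos_def V"
  shows "(x, l, u) \<in> Z_set m V \<delta> \<epsilon> \<longleftrightarrow> (l - x \<bullet> m, u - x \<bullet> m, dual_norm V x) \<in> Z1_set \<delta> \<epsilon>"
proof (cases "x = 0")
  case True
  then show ?thesis
    using Z_set_zero_iff[of \<delta> \<epsilon> V l u m] Z1_set_zero[OF assms(1-3), of l u] Z1_set_signs[OF assms(1-3), of l u 0] assms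
    by auto
next
  case False
  then show ?thesis
    using Z_set_nonzero_iff[of \<delta> \<epsilon> V x l u m] Z1_set_pos_iff[OF assms(1-3) dual_norm_pos[OF V False]] assms by simp
qed

lemma Z_set_iff_ex:
  fixes x m :: "real^'n"
  assumes "0 < \<delta>" "0 < \<epsilon>" "\<epsilon> < 1 / 2" and V: "sym_pos_def V"
  shows "(x, l, u) \<in> Z_set m V \<delta> \<epsilon> \<longleftrightarrow> (\<exists>s \<ge> dual_norm V x. (l - x \<bullet> m, u - x \<bullet> m, s) \<in> Z1_set \<delta> \<epsilon>)"
  using Z_set_iff_Z1[OF assms, of x l u m] Z1_set_downward[OF assms(1-3) _ dual_norm_nonneg] by blast

lemma closed_Z_set:
  fixes m :: "real^'n"
  assumes "0 < \<delta>" "0 < \<epsilon>" "\<epsilon> < 1 / 2" and V: "sym_pos_def V"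
  shows "closed (Z_set m V \<delta> \<epsilon>)"
proof -
  define h where "h p = (fst (snd p) - fst p \<bullet> m, snd (snd p) - fst p \<bullet> m, dual_norm V (fst p))" for p :: "(real^'n) \<times> real \<times> real"
  have "Z_set m V \<delta> \<epsilon> = h -` Z1_set \<delta> \<epsilon>"
    using Z_set_iff_Z1[OF assms] by (auto simp: h_def)
  moreover have "continuous_on UNIV h"
    unfolding h_def
    by (intro continuous_intros continuous_on_compose2[OF continuous_dual_norm[of UNIV]]) auto
  ultimately show ?thesis
    using closed_vimage[OF closed_Z1_set] by metis
qed

text \<open>The dual norm is only convex, not affine; the slack it leaves is exactly what the quantifier \<open>s \<ge> dual_norm V x\<close>
  absorbs.\<close>

lemma convex_Z_set:
  fixes m :: "real^'n"
  assumes "0 < \<delta>" "0 < \<epsilon>" "\<epsilon> < 1 / 2" and V: "sym_pos_def V"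
  shows "convex (Z_set m V \<delta> \<epsilon>)"
proof (rule convexI)
  fix p q :: "(real^'n) \<times> real \<times> real" and a b :: real
  assume pq: "p \<in> Z_set m V \<delta> \<epsilon>" "q \<in> Z_set m V \<delta> \<epsilon>" and ab: "0 \<le> a" "0 \<le> b" "a + b = 1"
  obtain x0 l0 u0 x1 l1 u1 where eq: "p = (x0, l0, u0)" "q = (x1, l1, u1)" by (cases p, cases q)
  have "a *\<^sub>R (l0 - x0 \<bullet> m, u0 - x0 \<bullet> m, dual_norm V x0) + b *\<^sub>R (l1 - x1 \<bullet> m, u1 - x1 \<bullet> m, dual_norm V x1) \<in> Z1_set \<delta> \<epsilon>"
    using pq ab by (intro convexD[OF convex_Z1_set[OF assms(1-3)]]) (simp_all add: eq Z_set_iff_Z1[OF assms])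
  then have "((a * l0 + b * l1) - (a *\<^sub>R x0 + b *\<^sub>R x1) \<bullet> m, (a * u0 + b * u1) - (a *\<^sub>R x0 + b *\<^sub>R x1) \<bullet> m,
      a * dual_norm V x0 + b * dual_norm V x1) \<in> Z1_set \<delta> \<epsilon>"
    by (simp add: algebra_simps inner_add_left)
  moreover have "dual_norm V (a *\<^sub>R x0 + b *\<^sub>R x1) \<le> a * dual_norm V x0 + b * dual_norm V x1"
    by (rule dual_norm_convex[OF ab(1,2)])
  ultimately have "(a *\<^sub>R x0 + b *\<^sub>R x1, a * l0 + b * l1, a * u0 + b * u1) \<in> Z_set m V \<delta> \<epsilon>"
    using Z_set_iff_ex[OF assms] by blast
  then show "a *\<^sub>R p + b *\<^sub>R q \<in> Z_set m V \<delta> \<epsilon>" by (simp add: eq)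
qed

theorem theorem1:
  fixes \<delta> \<epsilon> :: real and m :: "real^'n" and V :: "real^'n^'n"
  assumes "\<delta> > 0" and "0 < \<epsilon>" and "\<epsilon> < 1/2" and "sym_pos_def V"
  shows "Z0_set \<delta> \<epsilon> = {(l, u). \<delta> \<le> g \<epsilon> l u} \<and>
    (\<forall>(x :: real^'n) (l :: real) (u :: real).
       (x, l, u) \<in> Z_set m V \<delta> \<epsilon> \<longleftrightarrow>
       (\<exists>s \<ge> dual_norm V x. (l - x \<bullet> m, u - x \<bullet> m, s) \<in> Z1_set \<delta> \<epsilon>)) \<and>
    convex (Z0_set \<delta> \<epsilon>) \<and> closed (Z0_set \<delta> \<epsilon>) \<and>
    convex (Z_set m V \<delta> \<epsilon>) \<and> closed (Z_set m V \<delta> \<epsilon>)"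
  using Z0_set_eq[of \<delta> \<epsilon>] Z_set_iff_ex[OF assms] convex_Z0_set[OF assms(1-3)] closed_Z0_set[OF assms(1-3)]
    convex_Z_set[OF assms] closed_Z_set[OF assms] assms
  by auto

end
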